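(* Fix Hölder parameters $\alpha>\beta>0$ and constants $L(\alpha),L(\beta)>0$, and a noise level $\sigma>0$. Consider the dynamic pricing problem on $[p_{\min},1]$ with Gaussian demand $d_t\mid p_t=p \sim \mathcal N(f(p),\sigma^2)$. Suppose a policy $\pi$ (for each horizon $T$) satisfies $\sup_{f\in\mathcal H(\alpha,L(\alpha))}R^{\pi}(T)=\widetilde O\big(T^{\frac{\alpha+1}{2\alpha+1}}\big)$, i.e. it attains the optimal regret rate over $\mathcal H(\alpha,L(\alpha))$. Then there is a constant $C>0$ independent of $\pi$ such that, for all sufficiently large $T$, \[ \sup_{f\in\mathcal H(\beta,L(\beta))}R^{\pi}(T)\;\ge\; C\, T^{\frac{\beta+1}{2\beta+1}+\frac{\beta(\alpha-\beta)}{2(2\beta+1)^2(2\alpha+1)}} . \] In particular, $\pi$ cannot attain the rate $\widetilde O\big(T^{\frac{\beta+1}{2\beta+1}}\big)$ over $\mathcal H(\beta,L(\beta))$.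
   Context: Dynamic pricing model: fix $0<p_{\min}<1$. At each period $t=1,\dots,T$ a seller chooses a price $p_t\in[p_{\min},1]$ and observes a random demand $d_t$ with $\mathbb E[d_t\mid p_t=p]=f(p)$ for an unknown demand function $f$. An admissible policy $\pi$ is a sequence of (possibly randomized) maps $\pi_t:(p_1,d_1,\dots,p_{t-1},d_{t-1})\mapsto p_t$. With $p^*\in\arg\max_{p\in[p_{\min},1]}pf(p)$, the regret is $R^\pi(T)=\mathbb E^\pi\big[\sum_{t=1}^T (p^*f(p^* )-p_tf(p_t))\big]$. Hölder class: for $\beta>0$ let $w(\beta)$ be the largest integer strictly smaller than $\beta$. $\mathcal H_0(\beta,L)$ is the set of $w(\beta)$ times continuously differentiable $g:[p_{\min},1]\to\mathbb R$ with $\sup_p|g^{(k)}(p)|\le L$ for all $0\le k\le w(\beta)$ and $|g^{(w(\beta))}(p)-g^{(w(\beta))}(p')|\le L|p-p'|^{\beta-w(\beta)}$ for all $p,p'$. Set $\mathcal H(\beta,L)=\mathcal H_0(\beta,L)$ if $0<\beta<1$ and $\mathcal H(\beta,L)=\mathcal H_0(\beta,L)\cap\mathcal H_0(1,L)$ if $\beta\ge1$. $\widetilde O$ hides constants and polylogarithmic factors in $T$. *)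

theory Defs
  imports "HOL-Probability.Probability"
begin

definition wdeg :: "real \<Rightarrow> nat" where
  "wdeg \<beta> = nat (\<lceil>\<beta>\<rceil> - 1)"

text \<open>H_0(beta,L) on [pmin,1]; derivatives on the closed interval are one-sided
  at the endpoints (derivative within the interval). D k is the k-th derivative.\<close>
definition holder0 :: "real \<Rightarrow> real \<Rightarrow> real \<Rightarrow> (real \<Rightarrow> real) set" where
  "holder0 pmin \<beta> L = {g. \<exists>D :: nat \<Rightarrow> real \<Rightarrow> real.
      (\<forall>x\<in>{pmin..1}. D 0 x = g x) \<and>
      (\<forall>k<wdeg \<beta>. \<forall>x\<in>{pmin..1}.
          (D k has_real_derivative D (Suc k) x) (at x within {pmin..1})) \<and>
      continuous_on {pmin..1} (D (wdeg \<beta>)) \<and>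
      (\<forall>k\<le>wdeg \<beta>. \<forall>x\<in>{pmin..1}. \<bar>D k x\<bar> \<le> L) \<and>
      (\<forall>x\<in>{pmin..1}. \<forall>y\<in>{pmin..1}.
          \<bar>D (wdeg \<beta>) x - D (wdeg \<beta>) y\<bar> \<le> L * \<bar>x - y\<bar> powr (\<beta> - real (wdeg \<beta>)))}"

definition Hclass :: "real \<Rightarrow> real \<Rightarrow> real \<Rightarrow> (real \<Rightarrow> real) set" where
  "Hclass pmin \<beta> L =
     (if \<beta> < 1 then holder0 pmin \<beta> L else holder0 pmin \<beta> L \<inter> holder0 pmin 1 L)"

text \<open>A policy: \<pi> T t h u is the price at (0-indexed) period t < T for horizon T,
  given history h (the restriction to {..<t} of the past price/demand pairs) and
  a fresh uniform[0,1] random seed u (randomization).\<close>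
type_synonym policy = "nat \<Rightarrow> nat \<Rightarrow> (nat \<Rightarrow> real \<times> real) \<Rightarrow> real \<Rightarrow> real"

definition admissible :: "real \<Rightarrow> policy \<Rightarrow> bool" where
  "admissible pmin \<pi> \<longleftrightarrow>
     (\<forall>T t h u. \<pi> T t h u \<in> {pmin..1}) \<and>
     (\<forall>T t. (\<lambda>(h, u). \<pi> T t h u) \<in>
         (PiM {..<t} (\<lambda>_. borel :: (real \<times> real) measure)) \<Otimes>\<^sub>M (borel :: real measure) \<rightarrow>\<^sub>M borel)"

text \<open>Exogenous randomness per period: (seed, standard normal noise).\<close>
definition noise1 :: "(real \<times> real) measure" where
  "noise1 = uniform_measure lborel {0..1} \<Otimes>\<^sub>M density lborel std_normal_density"

definition noise :: "nat \<Rightarrow> (nat \<Rightarrow> real \<times> real) measure" where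
  "noise T = PiM {..<T} (\<lambda>_. noise1)"

text \<open>History of (price, demand) pairs; demand d_t = f(p_t) + sigma * eps_t,
  i.e. d_t | p_t = p ~ N(f p, sigma^2).\<close>
primrec hist :: "(nat \<Rightarrow> (nat \<Rightarrow> real \<times> real) \<Rightarrow> real \<Rightarrow> real) \<Rightarrow> (real \<Rightarrow> real) \<Rightarrow> real
    \<Rightarrow> (nat \<Rightarrow> real \<times> real) \<Rightarrow> nat \<Rightarrow> (real \<times> real) list" where
  "hist P f \<sigma> \<omega> 0 = []"
| "hist P f \<sigma> \<omega> (Suc t) =
     (let h = hist P f \<sigma> \<omega> t;
          p = P t (\<lambda>i\<in>{..<t}. h ! i) (fst (\<omega> t))
      in h @ [(p, f p + \<sigma> * snd (\<omega> t))])"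

definition regret :: "real \<Rightarrow> real \<Rightarrow> policy \<Rightarrow> (real \<Rightarrow> real) \<Rightarrow> nat \<Rightarrow> real" where
  "regret pmin \<sigma> \<pi> f T =
     (\<integral>\<omega>. (\<Sum>t<T. (SUP p\<in>{pmin..1}. p * f p)
                   - fst (hist (\<pi> T) f \<sigma> \<omega> T ! t) * f (fst (hist (\<pi> T) f \<sigma> \<omega> T ! t)))
        \<partial>noise T)"

end

theory Submission
  imports Defs "HOL-Real_Asymp.Real_Asymp" "HOL-Computational_Algebra.Polynomial"
begin

text \<open>
  Under the constant demand \<open>\<delta> = T powr (-\<gamma>)\<close>, which lies in every
  Hoelder class once \<open>T\<close> is large, the best price is 1 and
  every price in the left half of the interval costs at least a constant times \<open>\<delta>\<close>. A policy with
  regret \<open>R\<close> there visits the left half at most \<open>R / \<delta>\<close> times in expectation, up to constants. Among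
  the roughly \<open>\<delta> powr (-1/\<beta>)\<close> disjoint positions in the left half for a \<open>\<beta>\<close>-smooth bump of height of
  order \<open>\<delta>\<close>, one is therefore visited at most \<open>R * \<delta> powr (1/\<beta> - 1)\<close> times. If
  \<open>R * \<delta> powr (1/\<beta> + 1)\<close> is small, the policy cannot distinguish the constant demand from the demand with
  a bump at this position, on which it then has regret at least \<open>\<delta> * T / 2\<close>. The exponent \<open>1 - \<gamma>\<close> of
  the claim is strictly below what this argument permits, which absorbs the constants and logarithms.
\<close>

section \<open>Smooth bumps in Hoelder classes\<close>

lemma power_dvd_pderiv:
  fixes p q :: "'a :: {comm_semiring_1,semiring_no_zero_divisors,semiring_char_0} poly"
  assumes "q ^ Suc m dvd p"
  shows "q ^ m dvd pderiv p"
proof -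
  obtain r where "p = q ^ Suc m * r" using assms by (elim dvdE)
  then have "pderiv p = q ^ m * (q * pderiv r + r * smult (of_nat (Suc m)) (pderiv q))"
    by (simp only: pderiv_mult pderiv_power_Suc) (simp add: algebra_simps)
  then show ?thesis by simp
qed

text \<open>Each differentiation costs at most one factor of \<open>q\<close>. With
  \<open>q = 1 - x^2\<close> this makes the derivatives of the bump polynomial vanish at the cut
  points.\<close>

lemma power_dvd_higher_pderiv:
  fixes p q :: "'a :: {comm_semiring_1,semiring_no_zero_divisors,semiring_char_0} poly"
  assumes "q ^ (m + k) dvd p"
  shows "q ^ m dvd (pderiv ^^ k) p"
  using assms
proof (induction k arbitrary: m)
  case (Suc k)
  from Suc.IH[of "Suc m"] Suc.prems have "q ^ Suc m dvd (pderiv ^^ k) p" by simp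
  then show ?case by (simp add: power_dvd_pderiv)
qed simp

text \<open>Both functions vanish at \<open>x\<close>, so the difference quotient of
  \<open>g\<close> is squeezed by that of \<open>f\<close>. This differentiates the bump at its cut
  points, where it is a truncated polynomial.\<close>

lemma has_real_derivative_zero_dominated:
  fixes f g :: "real \<Rightarrow> real"
  assumes "(f has_real_derivative 0) (at x)" "f x = 0" "\<And>y. \<bar>g y\<bar> \<le> \<bar>f y\<bar>"
  shows "(g has_real_derivative 0) (at x)"
proof -
  have gx: "g x = 0" using assms(2) assms(3)[of x] by simp
  have "((\<lambda>y. (f y - f x) / (y - x)) \<longlongrightarrow> 0) (at x)"
    using assms(1) by (simp add: has_field_derivative_iff)
  then have "((\<lambda>y. (g y - g x) / (y - x)) \<longlongrightarrow> 0) (at x)"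
    by (rule Lim_null_comparison[rotated, OF tendsto_rabs_zero])
       (auto simp: gx assms(2,3) abs_divide intro!: always_eventually divide_right_mono)
  then show ?thesis by (simp add: has_field_derivative_iff)
qed

text \<open>The bump is \<open>(1 - x\<^sup>2) ^ (n + 2)\<close> cut off at \<open>\<plusminus>1\<close>, where it vanishes to high order.\<close>

lemma smooth_bump_exists:
  fixes n :: nat
  obtains \<phi> :: "nat \<Rightarrow> real \<Rightarrow> real" and M :: real where
    "M > 0" "\<phi> 0 0 = 1" "\<And>x. 1 \<le> \<bar>x\<bar> \<Longrightarrow> \<phi> 0 x = 0"
    "\<And>k x. k \<le> n \<Longrightarrow> (\<phi> k has_real_derivative \<phi> (Suc k) x) (at x)"
    "\<And>k x. k \<le> Suc n \<Longrightarrow> \<bar>\<phi> k x\<bar> \<le> M"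
proof -
  define q where "q = [:1, 0, -1 :: real:]"
  define P where "P k = (pderiv ^^ k) (q ^ (n + 2))" for k
  define \<phi> where "\<phi> k x = (if \<bar>x\<bar> < 1 then poly (P k) x else 0)" for k and x :: real
  \<comment> \<open>The exponent is \<open>n + 2 - k\<close>, written as a successor to show that a
    factor \<open>q\<close> survives for every order up to \<open>n + 1\<close>.\<close>
  have P_dvd: "q ^ Suc (Suc n - k) dvd P k" if "k \<le> Suc n" for k
    unfolding P_def by (rule power_dvd_higher_pderiv) (use that in simp)
  have q0: "poly q x = 0" if "\<bar>x\<bar> = 1" for x
    using that by (auto simp: q_def abs_if split: if_splits)
  have P0: "poly (P k) x = 0" if "k \<le> Suc n" "\<bar>x\<bar> = 1" for k x
    using P_dvd[OF that(1)] q0[OF that(2)] by (auto elim!: dvdE)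
  have deriv: "(\<phi> k has_real_derivative \<phi> (Suc k) x) (at x)" if "k \<le> n" for k x
  proof -
    have der: "(poly (P k) has_real_derivative poly (P (Suc k)) x) (at x)"
      by (simp add: P_def poly_DERIV)
    consider "\<bar>x\<bar> < 1" | "\<bar>x\<bar> > 1" | "\<bar>x\<bar> = 1" by linarith
    then show ?thesis
    proof cases
      case 1
      have "open {y::real. \<bar>y\<bar> < 1}" by (intro open_Collect_less continuous_intros)
      with der have "(\<phi> k has_real_derivative poly (P (Suc k)) x) (at x)"
        by (rule has_field_derivative_transform_within_open) (use 1 in \<open>auto simp: \<phi>_def\<close>)
      with 1 show ?thesis by (simp add: \<phi>_def)
    next
      case 2
      have "open {y::real. \<bar>y\<bar> > 1}" by (intro open_Collect_less continuous_intros)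
      with DERIV_const have "(\<phi> k has_real_derivative 0) (at x)"
        by (rule has_field_derivative_transform_within_open) (use 2 in \<open>auto simp: \<phi>_def\<close>)
      with 2 show ?thesis by (simp add: \<phi>_def)
    next
      case 3
      \<comment> \<open>At a cut point \<open>P k\<close> and \<open>P (Suc k)\<close> both vanish,
        so the polynomial has derivative 0 there, and it dominates its truncation.\<close>
      have "(\<phi> k has_real_derivative 0) (at x)"
        by (rule has_real_derivative_zero_dominated[of "poly (P k)"])
           (use der P0[of k x] P0[of "Suc k" x] that 3 in \<open>auto simp: \<phi>_def\<close>)
      with 3 show ?thesis by (simp add: \<phi>_def)
    qed
  qed
  have "\<exists>B. \<forall>x. \<bar>\<phi> k x\<bar> \<le> B \<and> 0 \<le> B" for k
  proof -
    have "compact (poly (P k) ` {-1..1})"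
      by (intro compact_continuous_image continuous_intros) auto
    then obtain B where B: "\<And>x. x \<in> {-1..1} \<Longrightarrow> \<bar>poly (P k) x\<bar> \<le> B"
      by (fastforce dest!: compact_imp_bounded simp: bounded_iff)
    have "\<bar>\<phi> k x\<bar> \<le> \<bar>B\<bar>" for x
    proof (cases "\<bar>x\<bar> < 1")
      case True
      then have "x \<in> {-1..1}" by auto
      from B[OF this] show ?thesis using True by (simp add: \<phi>_def)
    qed (simp add: \<phi>_def)
    then show ?thesis by (metis abs_ge_zero)
  qed
  then obtain B where B: "\<And>k x. \<bar>\<phi> k x\<bar> \<le> B k" "\<And>k. 0 \<le> B k" by metis
  \<comment> \<open>One bound serves all the finitely many orders; the summand 1 makes it strictly
    positive.\<close>
  have "\<bar>\<phi> k x\<bar> \<le> 1 + sum B {..Suc n}" if "k \<le> Suc n" for k x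
    using B(1)[of k x] member_le_sum[of k "{..Suc n}" B] B(2) that by auto
  moreover have "1 + sum B {..Suc n} > 0"
    using sum_nonneg[of "{..Suc n}" B, OF B(2)] by linarith
  moreover have "\<phi> 0 0 = 1" by (simp add: \<phi>_def P_def q_def)
  moreover have "\<phi> 0 x = 0" if "1 \<le> \<bar>x\<bar>" for x using that by (simp add: \<phi>_def)
  ultimately show ?thesis using that[of "1 + sum B {..Suc n}" \<phi>] deriv by blast
qed

section \<open>Constants and scaled bumps as members of the Hoelder classes\<close>

lemma wdeg_bounds:
  assumes "0 < \<beta>"
  shows "real (wdeg \<beta>) < \<beta>" "\<beta> \<le> real (wdeg \<beta>) + 1"
proof -
  have "0 < \<lceil>\<beta>\<rceil>" using assms by simp
  then have "real (wdeg \<beta>) = of_int \<lceil>\<beta>\<rceil> - 1" by (simp add: wdeg_def of_nat_nat)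
  then show "real (wdeg \<beta>) < \<beta>" "\<beta> \<le> real (wdeg \<beta>) + 1" by linarith+
qed

lemma const_in_holder0:
  assumes "0 < \<beta>" "0 \<le> \<delta>" "\<delta> \<le> L"
  shows "(\<lambda>_. \<delta>) \<in> holder0 pmin \<beta> L"
  unfolding holder0_def mem_Collect_eq
  by (rule exI[of _ "\<lambda>k _. if k = 0 then \<delta> else 0"]) (use assms in auto)

lemma const_in_Hclass:
  assumes "0 < \<beta>" "0 \<le> \<delta>" "\<delta> \<le> L"
  shows "(\<lambda>_. \<delta>) \<in> Hclass pmin \<beta> L"
  using assms by (auto simp: Hclass_def const_in_holder0)

text \<open>Rescaling to width \<open>h\<close> divides the \<open>k\<close>-th derivative by
  \<open>h ^ k\<close>, so a height \<open>B\<close> of order \<open>h powr \<beta>\<close> keeps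
  all seminorms bounded. The factor 4 confines the bump to \<open>L / 4\<close>, next to the
  \<open>L / 2\<close> allowed for \<open>\<delta>\<close>, and covers the factor 2 lost in the
  Hoelder seminorm.\<close>

lemma scaled_bump_in_holder0:
  fixes \<phi> :: "nat \<Rightarrow> real \<Rightarrow> real"
  assumes \<beta>: "0 < \<beta>" and h: "0 < h" "h \<le> 1" and M: "M > 0"
    and deriv: "\<And>k x. k \<le> wdeg \<beta> \<Longrightarrow> (\<phi> k has_real_derivative \<phi> (Suc k) x) (at x)"
    and bound: "\<And>k x. k \<le> Suc (wdeg \<beta>) \<Longrightarrow> \<bar>\<phi> k x\<bar> \<le> M"
    and B: "0 \<le> B" "4 * M * B \<le> L * h powr \<beta>" and \<delta>: "0 \<le> \<delta>" "\<delta> \<le> L / 2"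
  shows "(\<lambda>p. \<delta> + B * \<phi> 0 ((p - x0) / h)) \<in> holder0 pmin \<beta> L"
proof -
  define w where "w = wdeg \<beta>"
  have w: "real w < \<beta>" "\<beta> \<le> real w + 1" using wdeg_bounds[OF \<beta>] by (auto simp: w_def)
  define D where "D k p = (if k = 0 then \<delta> else 0) + B / h ^ k * \<phi> k ((p - x0) / h)" for k p
  have L: "0 \<le> L" using \<delta> by simp
  \<comment> \<open>As \<open>h \<le> 1\<close>, the larger exponent gives the smaller power. The
    condition on \<open>B\<close> at exponent \<open>\<beta>\<close> thus controls every order up to
    \<open>w\<close>.\<close>
  have hk: "h powr \<beta> \<le> h ^ k" if "k \<le> w" for k
    using h w that by (simp add: powr_realpow[symmetric]) (rule powr_mono', auto)
  have small: "B / h ^ k * M \<le> L / 4" if "k \<le> w" for k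
  proof -
    have "4 * M * B \<le> L * h ^ k"
      using B(2) mult_left_mono[OF hk[OF that] L] by linarith
    then show ?thesis using h by (simp add: field_simps)
  qed
  have der: "(D k has_real_derivative D (Suc k) p) (at p within S)" if "k \<le> w" for k p S
  proof -
    have "((\<lambda>p. \<phi> k ((p - x0) / h)) has_real_derivative \<phi> (Suc k) ((p - x0) / h) * (1 / h)) (at p)"
      by (rule DERIV_chain2[where f = "\<phi> k"])
         (use deriv[of k] that h in \<open>auto simp: w_def intro!: derivative_eq_intros\<close>)
    then have "(D k has_real_derivative D (Suc k) p) (at p)"
      unfolding D_def using h by (auto intro!: derivative_eq_intros simp: field_simps)
    then show ?thesis by (rule DERIV_subset) simp
  qed
  have Dbound: "\<bar>D k p\<bar> \<le> L" if "k \<le> w" for k p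
  proof -
    have "\<bar>B / h ^ k * \<phi> k ((p - x0) / h)\<bar> = B / h ^ k * \<bar>\<phi> k ((p - x0) / h)\<bar>"
      using B(1) h by (simp add: abs_mult)
    also have "\<dots> \<le> B / h ^ k * M"
      by (rule mult_left_mono) (use bound[of k] that B(1) h in \<open>auto simp: w_def\<close>)
    also have "\<dots> \<le> L / 4" by (rule small[OF that])
    finally have "\<bar>B / h ^ k * \<phi> k ((p - x0) / h)\<bar> \<le> L / 4" .
    moreover have "\<bar>if k = 0 then \<delta> else 0\<bar> \<le> L / 2" using \<delta> by auto
    ultimately show ?thesis using L unfolding D_def by linarith
  qed
  have holder: "\<bar>D w p - D w p'\<bar> \<le> L * \<bar>p - p'\<bar> powr (\<beta> - real w)" for p p'
  proof -
    define u where "u = (p - x0) / h"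
    define v where "v = (p' - x0) / h"
    have uv: "\<bar>u - v\<bar> = \<bar>p - p'\<bar> / h"
      using h by (simp add: u_def v_def abs_divide flip: diff_divide_distrib)
    have lip: "\<bar>\<phi> w u - \<phi> w v\<bar> \<le> M * \<bar>u - v\<bar>"
    proof -
      have "norm (\<phi> w u - \<phi> w v) \<le> M * norm (u - v)"
        by (rule field_differentiable_bound[of UNIV])
           (use deriv[of w] bound[of "Suc w"] in \<open>auto simp: w_def\<close>)
      then show ?thesis by simp
    qed
    have sup: "\<bar>\<phi> w u - \<phi> w v\<bar> \<le> 2 * M"
      using bound[of w u] bound[of w v] by (simp add: w_def)
    \<comment> \<open>Interpolation: at distance at most 1 the Lipschitz bound suffices because
      \<open>\<beta> - w \<le> 1\<close>, and beyond 1 the sup bound suffices because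
      \<open>\<beta> - w > 0\<close>.\<close>
    have "\<bar>\<phi> w u - \<phi> w v\<bar> \<le> 2 * M * \<bar>u - v\<bar> powr (\<beta> - real w)"
    proof (cases "\<bar>u - v\<bar> \<le> 1")
      case True
      have "\<bar>u - v\<bar> \<le> \<bar>u - v\<bar> powr (\<beta> - real w)"
        using powr_mono'[of "\<beta> - real w" 1 "\<bar>u - v\<bar>"] True w by (cases "u = v") auto
      then have "M * \<bar>u - v\<bar> \<le> M * \<bar>u - v\<bar> powr (\<beta> - real w)"
        using M by (intro mult_left_mono) auto
      moreover have "0 \<le> M * \<bar>u - v\<bar> powr (\<beta> - real w)" using M by simp
      ultimately show ?thesis using lip by simp
    next
      case False
      then have "1 \<le> \<bar>u - v\<bar> powr (\<beta> - real w)"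
        using w by (intro ge_one_powr_ge_zero) auto
      then have "2 * M * 1 \<le> 2 * M * \<bar>u - v\<bar> powr (\<beta> - real w)"
        using M by (intro mult_left_mono) auto
      then show ?thesis using sup by simp
    qed
    then have "B / h ^ w * \<bar>\<phi> w u - \<phi> w v\<bar> \<le> B / h ^ w * (2 * M * \<bar>u - v\<bar> powr (\<beta> - real w))"
      using B h by (intro mult_left_mono) auto
    also have "\<dots> = 2 * M * B / h powr \<beta> * \<bar>p - p'\<bar> powr (\<beta> - real w)"
      using h unfolding uv by (simp add: powr_divide powr_diff powr_realpow field_simps)
    also have "\<dots> \<le> L * \<bar>p - p'\<bar> powr (\<beta> - real w)"
    proof (rule mult_right_mono)
      have "2 * M * B \<le> L * h powr \<beta>" using B M mult_nonneg_nonneg[of M B] by linarith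
      then show "2 * M * B / h powr \<beta> \<le> L" using h by (simp add: field_simps)
    qed auto
    also have "B / h ^ w * \<bar>\<phi> w u - \<phi> w v\<bar> = \<bar>D w p - D w p'\<bar>"
    proof -
      have "D w p - D w p' = B / h ^ w * (\<phi> w u - \<phi> w v)"
        by (simp add: D_def u_def v_def right_diff_distrib)
      then show ?thesis using B(1) h by (simp add: abs_mult)
    qed
    finally show ?thesis .
  qed
  show ?thesis
    unfolding holder0_def mem_Collect_eq w_def[symmetric]
  proof (intro exI[of _ D] conjI ballI allI impI)
    show "continuous_on {pmin..1} (D w)"
      by (rule DERIV_continuous_on) (rule der, simp)
  qed (use der Dbound holder in \<open>auto simp: D_def\<close>)
qed

text \<open>For \<open>1 \<le> \<beta>\<close> the class also demands exponent 1. Since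
  \<open>h \<le> 1\<close> gives \<open>h powr \<beta> \<le> h\<close>, the same height condition
  implies the one for exponent 1.\<close>

lemma scaled_bump_in_Hclass:
  fixes \<phi> :: "nat \<Rightarrow> real \<Rightarrow> real"
  assumes \<beta>: "0 < \<beta>" and h: "0 < h" "h \<le> 1" and M: "M > 0"
    and deriv: "\<And>k x. k \<le> wdeg \<beta> \<Longrightarrow> (\<phi> k has_real_derivative \<phi> (Suc k) x) (at x)"
    and bound: "\<And>k x. k \<le> Suc (wdeg \<beta>) \<Longrightarrow> \<bar>\<phi> k x\<bar> \<le> M"
    and B: "0 \<le> B" "4 * M * B \<le> L * h powr \<beta>" and \<delta>: "0 \<le> \<delta>" "\<delta> \<le> L / 2"
  shows "(\<lambda>p. \<delta> + B * \<phi> 0 ((p - x0) / h)) \<in> Hclass pmin \<beta> L"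
proof -
  have "(\<lambda>p. \<delta> + B * \<phi> 0 ((p - x0) / h)) \<in> holder0 pmin 1 L" if "1 \<le> \<beta>"
  proof (rule scaled_bump_in_holder0[OF _ h M])
    have "h powr \<beta> \<le> h powr 1" using that h by (intro powr_mono') auto
    then have "L * h powr \<beta> \<le> L * h powr 1" using \<delta> by (intro mult_left_mono) auto
    then show "4 * M * B \<le> L * h powr 1" using B by linarith
  qed (use B \<delta> deriv bound in \<open>auto simp: wdeg_def\<close>)
  then show ?thesis
    using scaled_bump_in_holder0[of \<beta> h M \<phi> B L \<delta> x0 pmin] assms by (auto simp: Hclass_def)
qed

lemma Hclass_bounded:
  assumes "f \<in> Hclass pmin \<beta> L" "p \<in> {pmin..1}"
  shows "\<bar>f p\<bar> \<le> L"
proof -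
  have "f \<in> holder0 pmin \<beta> L" using assms(1) by (auto simp: Hclass_def split: if_splits)
  then obtain D :: "nat \<Rightarrow> real \<Rightarrow> real" where "\<forall>x\<in>{pmin..1}. D 0 x = f x"
    "\<forall>k\<le>wdeg \<beta>. \<forall>x\<in>{pmin..1}. \<bar>D k x\<bar> \<le> L"
    unfolding holder0_def by blast
  then show ?thesis using assms(2) by (metis le0)
qed

section \<open>Change of measure between demand functions\<close>

lemma measurable_fst_snd_borel [measurable]:
  "fst \<in> borel_measurable (borel :: (real \<times> real) measure)"
  "snd \<in> borel_measurable (borel :: (real \<times> real) measure)"
  by (auto intro!: borel_measurable_continuous_onI continuous_intros)

lemma sets_noise1 [measurable_cong]: "sets noise1 = sets (borel :: (real \<times> real) measure)"
proof -
  have "sets noise1 = sets ((borel :: real measure) \<Otimes>\<^sub>M (borel :: real measure))"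
    unfolding noise1_def by (intro sets_pair_measure_cong) auto
  then show ?thesis by (simp only: borel_prod)
qed

lemma measurable_noise1:
  "fst \<in> borel_measurable noise1" "snd \<in> borel_measurable noise1"
  unfolding measurable_cong_sets[OF sets_noise1 refl] by (rule measurable_fst_snd_borel)+

lemma sets_noise [measurable_cong]:
  "sets (noise T) = sets (PiM {..<T} (\<lambda>_. borel :: (real \<times> real) measure))"
  unfolding noise_def by (intro sets_PiM_cong) (auto simp: sets_noise1)

lemma prob_space_std_normal: "prob_space (density lborel std_normal_density)"
  by (rule prob_space_normal_density) simp

lemma prob_space_seed: "prob_space (uniform_measure lborel {0..1::real})"
  by (rule prob_space_uniform_measure) auto

interpretation seed_noise: pair_prob_space "uniform_measure lborel {0..1::real}"
    "density lborel std_normal_density"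
  by (intro pair_prob_space.intro pair_sigma_finite.intro prob_space_std_normal prob_space_seed
      prob_space_imp_sigma_finite)

lemma prob_space_noise1: "prob_space noise1"
  unfolding noise1_def by (rule seed_noise.prob_space_axioms)

interpretation noises: product_prob_space "\<lambda>_ :: nat. noise1" I for I
  by (rule product_prob_spaceI) (rule prob_space_noise1)

lemma prob_space_noise: "prob_space (noise T)"
  unfolding noise_def by (rule noises.prob_space_axioms)

interpretation noise: prob_space "noise T" for T
  by (rule prob_space_noise)

text \<open>Expanding the square shows that the shifted normal density is the standard one times
  \<open>exp (\<theta> * x - \<theta>\<^sup>2 / 2)\<close>. This is the one-period core of the
  change of measure.\<close>

lemma nn_integral_std_normal_shift:
  fixes G :: "real \<Rightarrow> ennreal"
  assumes [measurable]: "G \<in> borel_measurable borel"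
  shows "(\<integral>\<^sup>+x. G (x + \<theta>) \<partial>density lborel std_normal_density)
       = (\<integral>\<^sup>+x. G x * ennreal (exp (\<theta> * x - \<theta>\<^sup>2 / 2)) \<partial>density lborel std_normal_density)"
proof -
  have dens: "std_normal_density (x - \<theta>) = std_normal_density x * exp (\<theta> * x - \<theta>\<^sup>2 / 2)" for x
    by (simp add: std_normal_density_def power2_diff add_divide_distrib diff_divide_distrib
        algebra_simps flip: exp_add)
  have "(\<integral>\<^sup>+x. G (x + \<theta>) \<partial>density lborel std_normal_density)
      = (\<integral>\<^sup>+x. ennreal (std_normal_density x) * G (x + \<theta>) \<partial>lborel)"
    by (subst nn_integral_density) auto
  also have "\<dots> = (\<integral>\<^sup>+y. ennreal (std_normal_density (y - \<theta>)) * G y \<partial>lborel)"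
    by (subst nn_integral_real_affine[where c = 1 and t = \<theta>]) (auto simp: add.commute)
  also have "\<dots> = (\<integral>\<^sup>+y. ennreal (std_normal_density y) * (G y * ennreal (exp (\<theta> * y - \<theta>\<^sup>2 / 2))) \<partial>lborel)"
    by (simp add: dens ennreal_mult mult_ac)
  also have "\<dots> = (\<integral>\<^sup>+x. G x * ennreal (exp (\<theta> * x - \<theta>\<^sup>2 / 2)) \<partial>density lborel std_normal_density)"
    by (subst nn_integral_density) auto
  finally show ?thesis .
qed

lemma integrable_std_normal: "integrable (density lborel std_normal_density) (\<lambda>x. x)"
  using integrable_std_normal_moment[of 1] by (subst integrable_density) auto

lemma integral_std_normal: "(\<integral>x. x \<partial>density lborel std_normal_density) = 0"
  using integral_std_normal_moment_odd[of 0] by (subst integral_density) auto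

lemma integrable_noise1_snd: "integrable noise1 snd"
  unfolding noise1_def
proof (rule seed_noise.Fubini_integrable)
  show "snd \<in> borel_measurable (uniform_measure lborel {0..1::real} \<Otimes>\<^sub>M density lborel std_normal_density)"
    using measurable_snd[of "uniform_measure lborel {0..1::real}" "density lborel std_normal_density"]
    by (simp cong: measurable_cong_sets)
qed (auto simp: integrable_std_normal)

text \<open>Seed and Gaussian component are independent, so Fubini integrates the mean-zero noise
  with the seed held fixed. Boundedness of \<open>b\<close> supplies integrability.\<close>

lemma integral_noise1_centered:
  fixes b :: "real \<Rightarrow> real"
  assumes [measurable]: "b \<in> borel_measurable borel" and b: "\<And>u. \<bar>b u\<bar> \<le> C"
  shows "(\<integral>x. b (fst x) * snd x \<partial>noise1) = 0"
proof -
  have "integrable noise1 (\<lambda>x. b (fst x) * snd x)"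
    by (rule Bochner_Integration.integrable_bound[of _ "\<lambda>x. C * snd x"])
       (use b in \<open>auto simp: integrable_noise1_snd abs_mult intro!: mult_right_mono order_trans[OF b abs_ge_self]\<close>)
  then have "(\<integral>x. b (fst x) * snd x \<partial>noise1)
      = (\<integral>u. (\<integral>e. b u * e \<partial>density lborel std_normal_density) \<partial>uniform_measure lborel {0..1})"
    unfolding noise1_def by (subst seed_noise.integral_fst'[symmetric]) auto
  also have "\<dots> = 0" by (simp add: integral_std_normal)
  finally show ?thesis .
qed

lemma integrable_noise_snd:
  assumes "t < T"
  shows "integrable (noise T) (\<lambda>\<omega>. snd (\<omega> t))"
proof -
  have "integrable (distr (noise T) noise1 (\<lambda>\<omega>. \<omega> t)) snd"
    using noises.PiM_component[of t "{..<T}"] assms integrable_noise1_snd by (simp add: noise_def)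
  then show ?thesis
    by (subst (asm) integrable_distr_eq) (use assms in \<open>auto simp: noise_def\<close>)
qed

section \<open>The price and demand process for a fixed horizon\<close>

locale pricing =
  fixes P :: "nat \<Rightarrow> (nat \<Rightarrow> real \<times> real) \<Rightarrow> real \<Rightarrow> real" and \<sigma> :: real
  assumes sigma_pos: "0 < \<sigma>"
    and measurable_policy: "\<And>t. (\<lambda>(h, u). P t h u) \<in>
         (PiM {..<t} (\<lambda>_. borel :: (real \<times> real) measure)) \<Otimes>\<^sub>M (borel :: real measure) \<rightarrow>\<^sub>M borel"
begin

lemma measurable_policy_compose [measurable (raw)]:
  assumes "h \<in> N \<rightarrow>\<^sub>M PiM {..<t} (\<lambda>_. borel)" "u \<in> borel_measurable N"
  shows "(\<lambda>x. P t (h x) (u x)) \<in> borel_measurable N"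
  using measurable_compose[OF measurable_Pair[OF assms] measurable_policy] by simp

text \<open>The list becomes a function that is \<open>undefined\<close> from index \<open>t\<close>
  on. This is the form in which \<open>hist\<close> feeds the policy, and such functions are the
  points of the product space over \<open>{..<t}\<close>.\<close>

definition history :: "(real \<Rightarrow> real) \<Rightarrow> (nat \<Rightarrow> real \<times> real) \<Rightarrow> nat \<Rightarrow> nat \<Rightarrow> real \<times> real" where
  "history f \<omega> t = (\<lambda>i\<in>{..<t}. hist P f \<sigma> \<omega> t ! i)"

definition price :: "(real \<Rightarrow> real) \<Rightarrow> (nat \<Rightarrow> real \<times> real) \<Rightarrow> nat \<Rightarrow> real" where
  "price f \<omega> t = P t (history f \<omega> t) (fst (\<omega> t))"

lemma length_hist [simp]: "length (hist P f \<sigma> \<omega> t) = t"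
  by (induction t) (auto simp: Let_def)

lemma history_0 [simp]: "history f \<omega> 0 = (\<lambda>_. undefined)"
  by (simp add: history_def restrict_def)

lemma history_Suc:
  "history f \<omega> (Suc t) = (history f \<omega> t)(t := (price f \<omega> t, f (price f \<omega> t) + \<sigma> * snd (\<omega> t)))"
  by (auto simp: history_def price_def Let_def fun_eq_iff nth_append less_Suc_eq)

text \<open>Adaptedness of the process, used to integrate out the noise of period \<open>t\<close>
  while the history before it stays fixed.\<close>

lemma history_cong: "(\<And>i. i < t \<Longrightarrow> \<omega> i = \<omega>' i) \<Longrightarrow> history f \<omega> t = history f \<omega>' t"
  by (induction t) (auto simp: history_Suc price_def)

lemma history_nth:
  "t < T \<Longrightarrow> history f \<omega> T t = (price f \<omega> t, f (price f \<omega> t) + \<sigma> * snd (\<omega> t))"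
  by (induction T) (auto simp: history_Suc less_Suc_eq)

lemma fst_hist_nth: "t < T \<Longrightarrow> fst (hist P f \<sigma> \<omega> T ! t) = price f \<omega> t"
  using history_nth[of t T f \<omega>] by (simp add: history_def)

lemma measurable_history:
  assumes [measurable]: "f \<in> borel_measurable borel" and "t \<le> T"
  shows "(\<lambda>\<omega>. history f \<omega> t) \<in> noise T \<rightarrow>\<^sub>M PiM {..<t} (\<lambda>_. borel)"
  using assms(2)
proof (induction t)
  case 0
  then show ?case by (simp add: space_PiM)
next
  case (Suc t)
  then have [measurable]: "(\<lambda>\<omega>. history f \<omega> t) \<in> noise T \<rightarrow>\<^sub>M PiM {..<t} (\<lambda>_. borel)" by simp
  have [measurable]: "(\<lambda>\<omega>. \<omega> t) \<in> noise T \<rightarrow>\<^sub>M borel"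
    using Suc.prems unfolding measurable_cong_sets[OF sets_noise refl]
    by (intro measurable_component_singleton) auto
  show ?case unfolding history_Suc price_def
    by (rule measurable_fun_upd[where J = "{..<t}"]) (auto simp: lessThan_Suc)
qed

lemma measurable_price:
  assumes [measurable]: "f \<in> borel_measurable borel" and "t < T"
  shows "(\<lambda>\<omega>. price f \<omega> t) \<in> borel_measurable (noise T)"
proof -
  have [measurable]: "(\<lambda>\<omega>. history f \<omega> t) \<in> noise T \<rightarrow>\<^sub>M PiM {..<t} (\<lambda>_. borel)"
    using assms by (intro measurable_history) auto
  have [measurable]: "(\<lambda>\<omega>. \<omega> t) \<in> noise T \<rightarrow>\<^sub>M borel"
    using assms unfolding measurable_cong_sets[OF sets_noise refl]
    by (intro measurable_component_singleton) auto
  show ?thesis unfolding price_def by measurable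
qed

section \<open>Change of measure along the history\<close>

definition step_integral ::
  "(real \<Rightarrow> real) \<Rightarrow> nat \<Rightarrow> ((nat \<Rightarrow> real \<times> real) \<Rightarrow> ennreal) \<Rightarrow> (nat \<Rightarrow> real \<times> real) \<Rightarrow> ennreal" where
  "step_integral f t F h =
    (\<integral>\<^sup>+x. F (h(t := (P t h (fst x), f (P t h (fst x)) + \<sigma> * snd x))) \<partial>noise1)"

lemma measurable_history_step:
  assumes [measurable]: "f \<in> borel_measurable borel"
    "h \<in> N \<rightarrow>\<^sub>M PiM {..<t} (\<lambda>_. borel)" "u \<in> borel_measurable N" "e \<in> borel_measurable N"
  shows "(\<lambda>x. (h x)(t := (P t (h x) (u x), f (P t (h x) (u x)) + \<sigma> * e x)))
    \<in> N \<rightarrow>\<^sub>M PiM {..<Suc t} (\<lambda>_. borel)"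
  by (rule measurable_fun_upd[where J = "{..<t}"]) (auto simp: lessThan_Suc)

lemma measurable_step_integral:
  assumes [measurable]: "f \<in> borel_measurable borel"
    "F \<in> borel_measurable (PiM {..<Suc t} (\<lambda>_. borel))"
  shows "step_integral f t F \<in> borel_measurable (PiM {..<t} (\<lambda>_. borel))"
proof -
  have [measurable]: "(\<lambda>y. F ((fst y)(t := (P t (fst y) (fst (snd y)),
      f (P t (fst y) (fst (snd y))) + \<sigma> * snd (snd y)))))
      \<in> borel_measurable (PiM {..<t} (\<lambda>_. borel) \<Otimes>\<^sub>M noise1)"
    by (rule measurable_compose[OF measurable_history_step]) measurable
  show ?thesis unfolding step_integral_def
    by (rule noises.M.borel_measurable_nn_integral) (simp add: split_beta')
qed

text \<open>The noise is a product measure and the history before period \<open>t\<close> ignores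
  coordinate \<open>t\<close>, so that coordinate can be integrated first.
  \<open>step_integral\<close> is the resulting transition operator.\<close>

lemma nn_integral_history_Suc:
  assumes [measurable]: "f \<in> borel_measurable borel"
    "F \<in> borel_measurable (PiM {..<Suc t} (\<lambda>_. borel))"
  shows "(\<integral>\<^sup>+\<omega>. F (history f \<omega> (Suc t)) \<partial>noise (Suc t))
       = (\<integral>\<^sup>+\<omega>. step_integral f t F (history f \<omega> t) \<partial>noise t)"
proof -
  have upd: "history f (w(t := x)) (Suc t) =
      (history f w t)(t := (P t (history f w t) (fst x), f (P t (history f w t) (fst x)) + \<sigma> * snd x))"
    for w x
  proof -
    have "history f (w(t := x)) t = history f w t" by (rule history_cong) auto
    then show ?thesis by (simp add: history_Suc price_def)
  qed
  have "(\<lambda>\<omega>. F (history f \<omega> (Suc t))) \<in> borel_measurable (noise (Suc t))"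
    using measurable_compose[OF measurable_history[OF assms(1) order_refl] assms(2)] .
  then show ?thesis
    unfolding noise_def lessThan_Suc
    by (subst noises.product_nn_integral_insert) (auto simp: upd step_integral_def)
qed

text \<open>Logarithm of the density of the normal law with mean \<open>g p\<close> relative to that
  with mean \<open>f p\<close>, both of variance \<open>\<sigma>\<^sup>2\<close>, at the observed
  demand. It is written through the standardised shift and the standardised residual under
  \<open>f\<close>.\<close>

definition log_ratio :: "(real \<Rightarrow> real) \<Rightarrow> (real \<Rightarrow> real) \<Rightarrow> real \<times> real \<Rightarrow> real" where
  "log_ratio f g x = (g (fst x) - f (fst x)) / \<sigma> * ((snd x - f (fst x)) / \<sigma>)
     - ((g (fst x) - f (fst x)) / \<sigma>)\<^sup>2 / 2"

lemma measurable_log_ratio [measurable]: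
  assumes [measurable]: "f \<in> borel_measurable borel" "g \<in> borel_measurable borel"
  shows "log_ratio f g \<in> borel_measurable borel"
  unfolding log_ratio_def by measurable

text \<open>Given history and seed, the price is the same under both demand functions; only the mean
  demand moves, by \<open>(g p - f p) / \<sigma>\<close> standard deviations. The Gaussian shift
  formula applies to the inner integral.\<close>

lemma step_integral_change:
  assumes f [measurable]: "f \<in> borel_measurable borel" and g [measurable]: "g \<in> borel_measurable borel"
    and F: "F \<in> borel_measurable (PiM {..<Suc t} (\<lambda>_. borel))"
    and h: "h \<in> space (PiM {..<t} (\<lambda>_. borel :: (real \<times> real) measure))"
  shows "step_integral g t F h = step_integral f t (\<lambda>k. F k * ennreal (exp (log_ratio f g (k t)))) h"
proof -
  have comp [measurable]: "(\<lambda>k. k t) \<in> PiM {..<Suc t} (\<lambda>_. borel :: (real \<times> real) measure) \<rightarrow>\<^sub>M borel"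
    by (rule measurable_component_singleton) simp
  have h_const: "(\<lambda>_. h) \<in> N \<rightarrow>\<^sub>M PiM {..<t} (\<lambda>_. borel)" for N :: "'b measure"
    using h by (rule measurable_const)
  have fub: "step_integral f' t F' h = (\<integral>\<^sup>+u. (\<integral>\<^sup>+e. F' (h(t := (P t h u, f' (P t h u) + \<sigma> * e)))
      \<partial>density lborel std_normal_density) \<partial>uniform_measure lborel {0..1})"
    if f': "f' \<in> borel_measurable borel" and F': "F' \<in> borel_measurable (PiM {..<Suc t} (\<lambda>_. borel))"
    for f' F'
  proof -
    have "(\<lambda>x. F' (h(t := (P t h (fst x), f' (P t h (fst x)) + \<sigma> * snd x)))) \<in> borel_measurable noise1"
      by (rule measurable_compose[OF measurable_history_step[OF f' h_const measurable_noise1] F'])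
    then show ?thesis unfolding step_integral_def noise1_def
      by (subst seed_noise.M2.nn_integral_fst[symmetric]) simp_all
  qed
  have inner: "(\<integral>\<^sup>+e. F (h(t := (p, g p + \<sigma> * e))) \<partial>density lborel std_normal_density)
      = (\<integral>\<^sup>+e. F (h(t := (p, f p + \<sigma> * e))) * ennreal (exp (log_ratio f g (p, f p + \<sigma> * e)))
          \<partial>density lborel std_normal_density)" for p
  proof -
    define \<theta> where "\<theta> = (g p - f p) / \<sigma>"
    have 1: "g p + \<sigma> * e = f p + \<sigma> * (e + \<theta>)" for e
      using sigma_pos by (simp add: \<theta>_def field_simps)
    have 2: "log_ratio f g (p, f p + \<sigma> * e) = \<theta> * e - \<theta>\<^sup>2 / 2" for e
      using sigma_pos by (simp add: log_ratio_def \<theta>_def)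
    have "(\<lambda>e. h(t := (p, f p + \<sigma> * e))) \<in> borel \<rightarrow>\<^sub>M PiM {..<Suc t} (\<lambda>_. borel)"
      by (rule measurable_fun_upd[where J = "{..<t}"]) (auto simp: lessThan_Suc intro: h_const)
    from measurable_compose[OF this F] show ?thesis unfolding 1 2
      by (rule nn_integral_std_normal_shift)
  qed
  have "(\<lambda>k. F k * ennreal (exp (log_ratio f g (k t)))) \<in> borel_measurable (PiM {..<Suc t} (\<lambda>_. borel))"
    using F by measurable
  then show ?thesis
    by (simp add: fub[OF g F] fub[OF f] inner)
qed

text \<open>A discrete Girsanov formula by induction on the number of periods. The last period is
  integrated out, the induction hypothesis moves the earlier periods from \<open>g\<close> to
  \<open>f\<close>, and \<open>step_integral_change\<close> moves the last one, so the ratios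
  multiply.\<close>

lemma change_of_measure:
  assumes f [measurable]: "f \<in> borel_measurable borel" and g [measurable]: "g \<in> borel_measurable borel"
    and "F \<in> borel_measurable (PiM {..<t} (\<lambda>_. borel))"
  shows "(\<integral>\<^sup>+\<omega>. F (history g \<omega> t) \<partial>noise t)
       = (\<integral>\<^sup>+\<omega>. F (history f \<omega> t) * ennreal (exp (\<Sum>i<t. log_ratio f g (history f \<omega> t i))) \<partial>noise t)"
  using assms(3)
proof (induction t arbitrary: F)
  case 0
  then show ?case by simp
next
  case (Suc t)
  note F = Suc.prems
  have comp: "(\<lambda>k. k i) \<in> PiM {..<n} (\<lambda>_. borel :: (real \<times> real) measure) \<rightarrow>\<^sub>M borel"
    if "i < n" for i n
    using that by (intro measurable_component_singleton) simp
  define M where "M n k = ennreal (exp (\<Sum>i<n. log_ratio f g (k i)))" for n and k :: "nat \<Rightarrow> real \<times> real"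
  have M_meas: "M n \<in> borel_measurable (PiM {..<n} (\<lambda>_. borel))" for n
  proof -
    have "(\<lambda>k. log_ratio f g (k i)) \<in> borel_measurable (PiM {..<n} (\<lambda>_. borel))" if "i < n" for i
      by (rule measurable_compose[OF comp[OF that] measurable_log_ratio[OF f g]])
    then have [measurable]: "(\<lambda>k. \<Sum>i<n. log_ratio f g (k i)) \<in> borel_measurable (PiM {..<n} (\<lambda>_. borel))"
      by (intro borel_measurable_sum) auto
    show ?thesis unfolding M_def by measurable
  qed
  have "(\<integral>\<^sup>+\<omega>. F (history g \<omega> (Suc t)) \<partial>noise (Suc t))
      = (\<integral>\<^sup>+\<omega>. step_integral g t F (history g \<omega> t) \<partial>noise t)"
    by (rule nn_integral_history_Suc[OF g F])
  also have "\<dots> = (\<integral>\<^sup>+\<omega>. step_integral g t F (history f \<omega> t) * M t (history f \<omega> t) \<partial>noise t)"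
    unfolding M_def by (rule Suc.IH[OF measurable_step_integral[OF g F]])
  also have "\<dots> = (\<integral>\<^sup>+\<omega>. step_integral f t (\<lambda>k. F k * M (Suc t) k) (history f \<omega> t) \<partial>noise t)"
  proof (rule nn_integral_cong)
    fix \<omega> assume "\<omega> \<in> space (noise t)"
    define h where "h = history f \<omega> t"
    have h: "h \<in> space (PiM {..<t} (\<lambda>_. borel))"
      unfolding h_def by (rule measurable_space[OF measurable_history[OF f order_refl]]) fact
    have "(\<lambda>x. h(t := (P t h (fst x), f (P t h (fst x)) + \<sigma> * snd x)))
        \<in> noise1 \<rightarrow>\<^sub>M PiM {..<Suc t} (\<lambda>_. borel)"
      by (rule measurable_history_step[OF f measurable_const[OF h]]) measurable
    note [measurable] = this measurable_compose[OF this F]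
      measurable_compose[OF measurable_compose[OF this comp[OF lessI]] measurable_log_ratio[OF f g], simplified]
    have "step_integral g t F h * M t h = step_integral f t (\<lambda>k. F k * ennreal (exp (log_ratio f g (k t)))) h * M t h"
      by (simp only: step_integral_change[OF f g F h])
    also have "\<dots> = (\<integral>\<^sup>+x. F (h(t := (P t h (fst x), f (P t h (fst x)) + \<sigma> * snd x)))
        * ennreal (exp (log_ratio f g (P t h (fst x), f (P t h (fst x)) + \<sigma> * snd x))) * M t h \<partial>noise1)"
      unfolding step_integral_def by (subst nn_integral_multc[symmetric]) simp_all
    also have "\<dots> = step_integral f t (\<lambda>k. F k * M (Suc t) k) h"
      unfolding step_integral_def
      by (intro nn_integral_cong) (simp add: M_def exp_add ennreal_mult mult_ac)
    finally show "step_integral g t F (history f \<omega> t) * M t (history f \<omega> t)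
      = step_integral f t (\<lambda>k. F k * M (Suc t) k) (history f \<omega> t)"
      unfolding h_def .
  qed
  also have "\<dots> = (\<integral>\<^sup>+\<omega>. F (history f \<omega> (Suc t)) * M (Suc t) (history f \<omega> (Suc t)) \<partial>noise (Suc t))"
    by (rule nn_integral_history_Suc[OF f, symmetric]) (use F M_meas[of "Suc t"] in measurable)
  finally show ?case unfolding M_def .
qed

section \<open>Comparing expectations under two demand functions\<close>

lemma centered_noise:
  assumes f [measurable]: "f \<in> borel_measurable borel" and b [measurable]: "b \<in> borel_measurable borel"
    and C: "\<And>p. \<bar>b p\<bar> \<le> C" and t: "t < T"
  shows "integrable (noise T) (\<lambda>\<omega>. b (price f \<omega> t) * snd (\<omega> t))"
    and "(\<integral>\<omega>. b (price f \<omega> t) * snd (\<omega> t) \<partial>noise T) = 0"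
proof -
  have [measurable]: "(\<lambda>\<omega>. price f \<omega> t) \<in> borel_measurable (noise T)"
    by (rule measurable_price) fact+
  have [measurable]: "(\<lambda>\<omega>. snd (\<omega> t)) \<in> borel_measurable (noise T)"
    by (rule borel_measurable_integrable[OF integrable_noise_snd[OF t]])
  show int: "integrable (noise T) (\<lambda>\<omega>. b (price f \<omega> t) * snd (\<omega> t))"
    by (rule Bochner_Integration.integrable_bound[of _ "\<lambda>\<omega>. C * snd (\<omega> t)"])
       (auto simp: integrable_noise_snd t abs_mult intro!: mult_right_mono order_trans[OF C abs_ge_self])
  have T: "{..<T} = insert t ({..<T} - {t})" using t by auto
  \<comment> \<open>With the other coordinates frozen, the price of period \<open>t\<close> depends
    on coordinate \<open>t\<close> only through the seed, which is independent of that period's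
    Gaussian noise.\<close>
  have "(\<integral>x. b (price f (w(t := x)) t) * snd x \<partial>noise1) = 0"
    if "w \<in> space (PiM ({..<T} - {t}) (\<lambda>_. noise1))" for w
  proof -
    define h where "h = history f w t"
    have "history f (w(t := x)) t = h" for x
      unfolding h_def by (rule history_cong) auto
    then have price: "price f (w(t := x)) t = P t h (fst x)" for x
      by (simp add: price_def)
    have "restrict w {..<t} \<in> space (noise t)"
      using that t by (auto simp: noise_def space_PiM PiE_def)
    then have "history f (restrict w {..<t}) t \<in> space (PiM {..<t} (\<lambda>_. borel))"
      by (rule measurable_space[OF measurable_history[OF f order_refl]])
    also have "history f (restrict w {..<t}) t = h"
      unfolding h_def by (rule history_cong) auto
    finally have h: "h \<in> space (PiM {..<t} (\<lambda>_. borel))" .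
    have "(\<lambda>u. P t h u) \<in> borel_measurable borel"
      by (rule measurable_policy_compose[OF measurable_const[OF h]]) simp
    from measurable_compose[OF this b] C show ?thesis unfolding price
      by (rule integral_noise1_centered)
  qed
  then show "(\<integral>\<omega>. b (price f \<omega> t) * snd (\<omega> t) \<partial>noise T) = 0"
    using noises.product_integral_insert[of "{..<T} - {t}" t "\<lambda>\<omega>. b (price f \<omega> t) * snd (\<omega> t)"] int
    unfolding noise_def T[symmetric] by (simp cong: Bochner_Integration.integral_cong)
qed

text \<open>With \<open>M\<close> the likelihood ratio, integrate the inequality
  \<open>ln M \<le> M * (1 - W / 2) - 1 + W\<close>.\<close>

lemma expectation_change_bound:
  assumes f [measurable]: "f \<in> borel_measurable borel" and g [measurable]: "g \<in> borel_measurable borel"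
    and C: "\<And>p. \<bar>g p - f p\<bar> \<le> C"
    and W [measurable]: "W \<in> borel_measurable (PiM {..<T} (\<lambda>_. borel))"
    and W01: "\<And>h. 0 \<le> W h" "\<And>h. W h \<le> 1"
  shows "(\<integral>\<omega>. W (history g \<omega> T) \<partial>noise T) \<le> 2 * (\<integral>\<omega>. W (history f \<omega> T) \<partial>noise T)
      + (\<integral>\<omega>. (\<Sum>t<T. ((g (price f \<omega> t) - f (price f \<omega> t)) / \<sigma>)\<^sup>2) \<partial>noise T)"
proof -
  have hist_meas [measurable]: "(\<lambda>\<omega>. history f \<omega> T) \<in> noise T \<rightarrow>\<^sub>M PiM {..<T} (\<lambda>_. borel)"
    "(\<lambda>\<omega>. history g \<omega> T) \<in> noise T \<rightarrow>\<^sub>M PiM {..<T} (\<lambda>_. borel)"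
    by (auto intro: measurable_history)
  define \<theta> where "\<theta> p = (g p - f p) / \<sigma>" for p
  have [measurable]: "\<theta> \<in> borel_measurable borel" unfolding \<theta>_def by measurable
  have \<theta>: "\<bar>\<theta> p\<bar> \<le> C / \<sigma>" for p
    using C[of p] sigma_pos by (simp add: \<theta>_def abs_divide divide_right_mono)
  define X where "X \<omega> = (\<Sum>i<T. log_ratio f g (history f \<omega> T i))" for \<omega>
  have X_eq: "X \<omega> = (\<Sum>t<T. \<theta> (price f \<omega> t) * snd (\<omega> t)) - (\<Sum>t<T. (\<theta> (price f \<omega> t))\<^sup>2) / 2" for \<omega>
    unfolding X_def sum_divide_distrib sum_subtractf[symmetric]
    by (rule sum.cong) (use sigma_pos in \<open>auto simp: history_nth log_ratio_def \<theta>_def\<close>)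
  have sq_int: "integrable (noise T) (\<lambda>\<omega>. (\<theta> (price f \<omega> t))\<^sup>2)" if "t < T" for t
  proof -
    have [measurable]: "(\<lambda>\<omega>. price f \<omega> t) \<in> borel_measurable (noise T)"
      by (rule measurable_price) fact+
    have "(\<theta> p)\<^sup>2 \<le> (C / \<sigma>)\<^sup>2" for p
      using \<theta>[of p] by (metis abs_ge_zero order_trans power2_abs power_mono)
    then show ?thesis
      by (intro noise.integrable_const_bound[where B = "(C / \<sigma>)\<^sup>2"]) auto
  qed
  have cent: "integrable (noise T) (\<lambda>\<omega>. \<theta> (price f \<omega> t) * snd (\<omega> t))"
    "(\<integral>\<omega>. \<theta> (price f \<omega> t) * snd (\<omega> t) \<partial>noise T) = 0" if "t < T" for t
    by (rule centered_noise[where C = "C / \<sigma>"]; use \<theta> that in simp)+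
  have X_int: "integrable (noise T) X"
    unfolding X_eq[abs_def] by (intro Bochner_Integration.integrable_diff integrable_divide
        Bochner_Integration.integrable_sum) (auto intro: cent sq_int)
  \<comment> \<open>The noise terms are centred, so only the squared shifts survive. Up to sign this
    is the Kullback-Leibler divergence of the history law under \<open>f\<close> relative to that
    under \<open>g\<close>.\<close>
  have X_integral: "(\<integral>\<omega>. X \<omega> \<partial>noise T) = - (\<integral>\<omega>. (\<Sum>t<T. (\<theta> (price f \<omega> t))\<^sup>2) \<partial>noise T) / 2"
    unfolding X_eq[abs_def] using cent sq_int
    by (subst Bochner_Integration.integral_diff)
       (auto simp: Bochner_Integration.integral_sum intro!: integrable_divide Bochner_Integration.integrable_sum)
  note [measurable] = borel_measurable_integrable[OF X_int]
  have "(\<integral>\<^sup>+\<omega>. ennreal (exp (X \<omega>)) \<partial>noise T) = 1"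
    using change_of_measure[OF f g, of "\<lambda>_. 1" T] by (simp add: X_def noise.emeasure_space_1)
  then have E: "integrable (noise T) (\<lambda>\<omega>. exp (X \<omega>))" "(\<integral>\<omega>. exp (X \<omega>) \<partial>noise T) = 1"
    by (auto intro!: integrableI_nn_integral_finite[where x = 1] simp: integral_eq_nn_integral)
  have EW_int: "integrable (noise T) (\<lambda>\<omega>. exp (X \<omega>) * W (history f \<omega> T))"
    by (rule Bochner_Integration.integrable_bound[OF E(1)])
       (auto simp: W01 abs_mult intro!: mult_left_le)
  have EW: "(\<integral>\<omega>. exp (X \<omega>) * W (history f \<omega> T) \<partial>noise T) = (\<integral>\<omega>. W (history g \<omega> T) \<partial>noise T)"
  proof -
    have "(\<integral>\<^sup>+\<omega>. ennreal (W (history g \<omega> T)) \<partial>noise T)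
        = (\<integral>\<^sup>+\<omega>. ennreal (exp (X \<omega>) * W (history f \<omega> T)) \<partial>noise T)"
      using change_of_measure[OF f g, of "\<lambda>h. ennreal (W h)" T]
      by (simp add: X_def ennreal_mult W01 mult.commute)
    then show ?thesis by (simp add: integral_eq_nn_integral W01)
  qed
  have W_int: "integrable (noise T) (\<lambda>\<omega>. W (history f \<omega> T))"
    by (rule noise.integrable_const_bound[where B = 1]) (auto simp: W01)
  have "X \<omega> \<le> (exp (X \<omega>) - exp (X \<omega>) * W (history f \<omega> T) / 2) - 1 + W (history f \<omega> T)" for \<omega>
  proof -
    define w where "w = W (history f \<omega> T)"
    \<comment> \<open>The bound \<open>ln x \<le> x - 1\<close> is used twice, at
      \<open>exp (X \<omega>) * c\<close> and at \<open>1 / c\<close>. The choice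
      \<open>c = 1 - w / 2\<close> stays positive and satisfies
      \<open>1 / c - 1 \<le> w\<close>.\<close>
    define c where "c = 1 - w / 2"
    have w: "0 \<le> w" "w \<le> 1" using W01 by (auto simp: w_def)
    then have c: "c > 0" by (simp add: c_def)
    have "X \<omega> + ln c = ln (exp (X \<omega>) * c)" using c by (simp add: ln_mult)
    also have "\<dots> \<le> exp (X \<omega>) * c - 1" using c by (intro ln_le_minus_one) auto
    finally have 1: "X \<omega> \<le> exp (X \<omega>) * c - 1 - ln c" by simp
    have "- ln c = ln (1 / c)" using c by (simp add: ln_div)
    also have "\<dots> \<le> 1 / c - 1" using c by (intro ln_le_minus_one) auto
    also have "\<dots> \<le> w"
    proof -
      have "0 \<le> w * (1 - w)" using w by simp
      then have "1 \<le> (1 + w) * c" by (simp add: c_def algebra_simps)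
      then show ?thesis using c by (simp add: field_simps)
    qed
    finally show ?thesis using 1 by (simp add: c_def w_def algebra_simps)
  qed
  then have "(\<integral>\<omega>. X \<omega> \<partial>noise T)
      \<le> (\<integral>\<omega>. (exp (X \<omega>) - exp (X \<omega>) * W (history f \<omega> T) / 2) - 1 + W (history f \<omega> T) \<partial>noise T)"
    using X_int E EW_int W_int by (intro integral_mono) auto
  also have "\<dots> = - (\<integral>\<omega>. W (history g \<omega> T) \<partial>noise T) / 2 + (\<integral>\<omega>. W (history f \<omega> T) \<partial>noise T)"
    using E EW_int W_int EW by (simp add: noise.prob_space)
  finally show ?thesis unfolding X_integral \<theta>_def by simp
qed

end

section \<open>Regret on a demand function with a hidden bump\<close>

text \<open>A real supremum dominates the members only of a set bounded above, so this accompanies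
  each use of \<open>cSUP_upper\<close> for revenues.\<close>

lemma bdd_above_revenue:
  fixes f :: "real \<Rightarrow> real"
  assumes "0 < pmin" "\<And>p. p \<in> {pmin..1} \<Longrightarrow> \<bar>f p\<bar> \<le> L"
  shows "bdd_above ((\<lambda>p. p * f p) ` {pmin..1})"
    and "p \<in> {pmin..1} \<Longrightarrow> \<bar>p * f p\<bar> \<le> L"
proof -
  have *: "\<bar>p * f p\<bar> \<le> L" if "p \<in> {pmin..1}" for p
  proof -
    have "\<bar>p * f p\<bar> \<le> 1 * L"
      unfolding abs_mult using that assms by (intro mult_mono) auto
    then show ?thesis by simp
  qed
  then show "p \<in> {pmin..1} \<Longrightarrow> \<bar>p * f p\<bar> \<le> L" .
  show "bdd_above ((\<lambda>p. p * f p) ` {pmin..1})"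
    by (rule bdd_aboveI2[of _ _ L]) (use * in \<open>blast intro: abs_le_D1\<close>)
qed

section \<open>Regret and visit counts along a run\<close>

locale admissible_pricing = pricing +
  fixes pmin :: real
  assumes pmin: "0 < pmin" "pmin < 1"
    and policy_range: "\<And>t h u. P t h u \<in> {pmin..1}"
begin

lemma price_range: "price f \<omega> t \<in> {pmin..1}"
  unfolding price_def by (rule policy_range)

definition run_regret :: "(real \<Rightarrow> real) \<Rightarrow> nat \<Rightarrow> (nat \<Rightarrow> real \<times> real) \<Rightarrow> real" where
  "run_regret f T \<omega> = (\<Sum>t<T. (SUP p\<in>{pmin..1}. p * f p) - price f \<omega> t * f (price f \<omega> t))"

definition visits :: "(real \<Rightarrow> real) \<Rightarrow> real set \<Rightarrow> nat \<Rightarrow> (nat \<Rightarrow> real \<times> real) \<Rightarrow> real" where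
  "visits f I T \<omega> = (\<Sum>t<T. indicator I (price f \<omega> t))"

lemma run_regret_le:
  assumes "\<And>p. p \<in> {pmin..1} \<Longrightarrow> \<bar>f p\<bar> \<le> L"
  shows "\<bar>run_regret f T \<omega>\<bar> \<le> 2 * L * real T"
proof -
  have bound: "bdd_above ((\<lambda>p. p * f p) ` {pmin..1})" "\<And>p. p \<in> {pmin..1} \<Longrightarrow> \<bar>p * f p\<bar> \<le> L"
    by (rule bdd_above_revenue[of pmin f L]; use pmin assms in simp)+
  have "(SUP p\<in>{pmin..1}. p * f p) \<le> L"
    by (rule cSUP_least) (use pmin bound(2) in \<open>auto intro: abs_le_D1\<close>)
  moreover have "1 * f 1 \<le> (SUP p\<in>{pmin..1}. p * f p)"
    using pmin by (intro cSUP_upper[of 1 _ "\<lambda>p. p * f p"] bound(1)) auto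
  ultimately have "\<bar>(SUP p\<in>{pmin..1}. p * f p) - price f \<omega> t * f (price f \<omega> t)\<bar> \<le> 2 * L" for t
    using bound(2)[OF price_range[of f \<omega> t]] bound(2)[of 1] pmin by auto
  then have "(\<Sum>t<T. \<bar>(SUP p\<in>{pmin..1}. p * f p) - price f \<omega> t * f (price f \<omega> t)\<bar>) \<le> (\<Sum>t<T. 2 * L)"
    by (intro sum_mono)
  then show ?thesis unfolding run_regret_def
    by (intro order_trans[OF sum_abs]) (simp add: mult.commute)
qed

lemma integrable_run_regret:
  assumes [measurable]: "f \<in> borel_measurable borel" and "\<And>p. p \<in> {pmin..1} \<Longrightarrow> \<bar>f p\<bar> \<le> L"
  shows "integrable (noise T) (run_regret f T)"
proof (rule noise.integrable_const_bound[where B = "2 * L * real T"])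
  have "(\<lambda>\<omega>. (SUP p\<in>{pmin..1}. p * f p) - price f \<omega> t * f (price f \<omega> t)) \<in> borel_measurable (noise T)"
    if "t < T" for t
  proof -
    have [measurable]: "(\<lambda>\<omega>. price f \<omega> t) \<in> borel_measurable (noise T)"
      by (rule measurable_price) fact+
    show ?thesis by measurable
  qed
  then show "run_regret f T \<in> borel_measurable (noise T)"
    unfolding run_regret_def[abs_def] by (intro borel_measurable_sum) auto
qed (use run_regret_le[OF assms(2)] in auto)

lemma visits_bounds: "0 \<le> visits f I T \<omega>" "visits f I T \<omega> \<le> real T"
proof -
  show "0 \<le> visits f I T \<omega>" unfolding visits_def by (intro sum_nonneg) auto
  have "visits f I T \<omega> \<le> (\<Sum>t<T. 1)"
    unfolding visits_def by (intro sum_mono) (auto simp: indicator_def)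
  then show "visits f I T \<omega> \<le> real T" by simp
qed

lemma integrable_visits:
  assumes [measurable]: "f \<in> borel_measurable borel" "I \<in> sets borel"
  shows "integrable (noise T) (visits f I T)"
proof (rule noise.integrable_const_bound[where B = "real T"])
  have "(\<lambda>\<omega>. indicator I (price f \<omega> t) :: real) \<in> borel_measurable (noise T)" if "t < T" for t
  proof -
    have [measurable]: "(\<lambda>\<omega>. price f \<omega> t) \<in> borel_measurable (noise T)"
      by (rule measurable_price) fact+
    show ?thesis by measurable
  qed
  then show "visits f I T \<in> borel_measurable (noise T)"
    unfolding visits_def[abs_def] by (intro borel_measurable_sum) auto
qed (use visits_bounds in auto)

text \<open>The information bound is applied to the fraction \<open>W\<close> of periods spent in
  \<open>I\<close>. As the demand functions differ only on \<open>I\<close>, the sum of squared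
  shifts is at most \<open>(C / \<sigma>)\<^sup>2\<close> times the visits under \<open>f\<close>,
  so both terms scale with the visits.\<close>

lemma expected_visits_change:
  assumes f: "f \<in> borel_measurable borel" and g: "g \<in> borel_measurable borel"
    and I [measurable]: "I \<in> sets borel" and C: "\<And>p. \<bar>g p - f p\<bar> \<le> C * indicator I p"
    and C0: "0 \<le> C" and T: "0 < T"
  shows "(\<integral>\<omega>. visits g I T \<omega> \<partial>noise T)
      \<le> (\<integral>\<omega>. visits f I T \<omega> \<partial>noise T) * (2 + real T * (C / \<sigma>)\<^sup>2)"
proof -
  define W where "W h = (\<Sum>t<T. indicator I (fst (h t))) / real T" for h :: "nat \<Rightarrow> real \<times> real"
  have W_hist: "W (history f' \<omega> T) = visits f' I T \<omega> / real T" for f' \<omega>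
    unfolding W_def visits_def
    by (intro arg_cong[of _ _ "\<lambda>x. x / real T"] sum.cong) (auto simp: history_nth)
  have W_meas: "W \<in> borel_measurable (PiM {..<T} (\<lambda>_. borel))"
    unfolding W_def[abs_def]
  proof (intro borel_measurable_divide borel_measurable_sum measurable_const)
    fix t assume "t \<in> {..<T}"
    then have "(\<lambda>h. h t) \<in> PiM {..<T} (\<lambda>_. borel :: (real \<times> real) measure) \<rightarrow>\<^sub>M borel"
      by (rule measurable_component_singleton)
    then show "(\<lambda>h. indicator I (fst (h t)) :: real) \<in> borel_measurable (PiM {..<T} (\<lambda>_. borel :: (real \<times> real) measure))"
      by measurable
  qed auto
  have W01: "0 \<le> W h" "W h \<le> 1" for h
  proof -
    have "(\<Sum>t<T. indicator I (fst (h t)) :: real) \<le> (\<Sum>t<T. 1)"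
      by (intro sum_mono) (auto simp: indicator_def)
    then show "W h \<le> 1" using T by (simp add: W_def)
  qed (auto simp: W_def intro!: divide_nonneg_nonneg sum_nonneg)
  have C': "\<bar>g p - f p\<bar> \<le> C" for p
    using C[of p] C0 by (cases "p \<in> I") auto
  have sq: "(\<Sum>t<T. ((g (price f \<omega> t) - f (price f \<omega> t)) / \<sigma>)\<^sup>2) \<le> (C / \<sigma>)\<^sup>2 * visits f I T \<omega>" for \<omega>
    unfolding visits_def sum_distrib_left
  proof (rule sum_mono)
    fix t
    define p where "p = price f \<omega> t"
    have "((g p - f p) / \<sigma>)\<^sup>2 \<le> (C / \<sigma>)\<^sup>2 * indicator I p"
    proof (cases "p \<in> I")
      case True
      have "\<bar>(g p - f p) / \<sigma>\<bar> \<le> C / \<sigma>"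
        using C'[of p] sigma_pos by (simp add: abs_divide divide_right_mono)
      from power_mono[OF this abs_ge_zero, of 2] show ?thesis
        using True by (simp only: power2_abs indicator_simps mult_1_right)
    qed (use C[of p] in simp)
    then show "((g (price f \<omega> t) - f (price f \<omega> t)) / \<sigma>)\<^sup>2 \<le> (C / \<sigma>)\<^sup>2 * indicator I (price f \<omega> t)"
      unfolding p_def .
  qed
  have "(\<integral>\<omega>. visits g I T \<omega> \<partial>noise T) / real T = (\<integral>\<omega>. W (history g \<omega> T) \<partial>noise T)"
    by (simp add: W_hist)
  also have "\<dots> \<le> 2 * (\<integral>\<omega>. W (history f \<omega> T) \<partial>noise T)
      + (\<integral>\<omega>. (\<Sum>t<T. ((g (price f \<omega> t) - f (price f \<omega> t)) / \<sigma>)\<^sup>2) \<partial>noise T)"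
    by (rule expectation_change_bound[OF f g C' W_meas W01])
  also have "\<dots> \<le> 2 * ((\<integral>\<omega>. visits f I T \<omega> \<partial>noise T) / real T)
      + (\<integral>\<omega>. (C / \<sigma>)\<^sup>2 * visits f I T \<omega> \<partial>noise T)"
    unfolding W_hist using integrable_visits[OF f I, of T] sq
    by (intro add_mono integral_mono') (auto intro!: mult_nonneg_nonneg visits_bounds)
  also have "\<dots> = (\<integral>\<omega>. visits f I T \<omega> \<partial>noise T) * (2 + real T * (C / \<sigma>)\<^sup>2) / real T"
    using T by (simp add: field_simps)
  finally show ?thesis using T by (simp add: divide_le_cancel)
qed

text \<open>Under the constant demand some interval receives at most
  \<open>R / (\<delta> * ((1 - pmin) / 2) * real K)\<close> expected visits. By
  \<open>small\<close>, the change of measure raises this to at most half of the periods, and each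
  remaining period loses \<open>\<delta>\<close>.\<close>

lemma needle_lower_bound:
  fixes \<phi> :: "real \<Rightarrow> real"
  assumes \<phi> [measurable]: "\<phi> \<in> borel_measurable borel" and \<phi>0: "\<phi> 0 = 1"
    and supp: "\<And>x. 1 \<le> \<bar>x\<bar> \<Longrightarrow> \<phi> x = 0" and M: "\<And>x. \<bar>\<phi> x\<bar> \<le> M"
    and \<delta>: "0 < \<delta>" and h: "0 < h" and K: "0 < K" and T: "0 < T"
    and fit: "pmin + 2 * h * real K \<le> (1 + pmin) / 2"
    and R: "(\<integral>\<omega>. run_regret (\<lambda>_. \<delta>) T \<omega> \<partial>noise T) \<le> R"
    and small: "R / (\<delta> * ((1 - pmin) / 2) * real K) * (2 + real T * (2 * \<delta> / pmin * M / \<sigma>)\<^sup>2) \<le> real T / 2"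
  shows "\<exists>x0. \<delta> * real T / 2 \<le>
     (\<integral>\<omega>. run_regret (\<lambda>p. \<delta> + 2 * \<delta> / pmin * \<phi> ((p - x0) / h)) T \<omega> \<partial>noise T)"
proof -
  define f0 where "f0 = (\<lambda>_ :: real. \<delta>)"
  have f0_meas: "f0 \<in> borel_measurable borel" by (simp add: f0_def)
  \<comment> \<open>Centres of adjacent intervals of radius \<open>h\<close>, starting at
    \<open>pmin\<close>; \<open>fit\<close> keeps the first \<open>K\<close> of them in the left
    half.\<close>
  define x where "x i = pmin + (2 * real i + 1) * h" for i :: nat
  define I where "I i = {p. \<bar>p - x i\<bar> < h}" for i
  have I_meas: "I i \<in> sets borel" for i unfolding I_def by measurable
  define E0 where "E0 i = (\<integral>\<omega>. visits f0 (I i) T \<omega> \<partial>noise T)" for i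
  have I_disj: "i = j" if "p \<in> I i" "p \<in> I j" for p i j
  proof -
    have "\<bar>x i - x j\<bar> < 2 * h" using that by (auto simp: I_def)
    moreover have "x i - x j = 2 * h * (real i - real j)" by (simp add: x_def algebra_simps)
    ultimately have "\<bar>real i - real j\<bar> < 1" using h by (simp add: abs_mult)
    then show ?thesis by linarith
  qed
  have I_left: "p \<le> (1 + pmin) / 2" if "p \<in> I i" "i < K" for p i
  proof -
    have "p \<le> x i + h" using that by (auto simp: I_def)
    also have "\<dots> = pmin + 2 * h * (real i + 1)" by (simp add: x_def algebra_simps)
    also have "\<dots> \<le> pmin + 2 * h * real K" using that h by simp
    finally show ?thesis using fit by simp
  qed
  \<comment> \<open>At constant demand the price \<open>p\<close> loses
    \<open>\<delta> * (1 - p)\<close>, at least \<open>\<delta> * ((1 - pmin) / 2)\<close> on the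
    left half. Disjointness makes the sum of indicators at most 1.\<close>
  have gap: "\<delta> * ((1 - pmin) / 2) * (\<Sum>i<K. indicator (I i) p) \<le> \<delta> - p * \<delta>" if "p \<in> {pmin..1}" for p
  proof (cases "\<exists>i<K. p \<in> I i")
    case True
    then obtain i where i: "i < K" "p \<in> I i" by blast
    have "(\<Sum>j<K. indicator (I j) p :: real) = (\<Sum>j\<in>{i}. indicator (I j) p)"
      using i I_disj by (intro sum.mono_neutral_right) (auto simp: indicator_def)
    then have "(\<Sum>j<K. indicator (I j) p :: real) = 1" using i by simp
    moreover have "\<delta> * ((1 - pmin) / 2) \<le> \<delta> * (1 - p)"
      using I_left[OF i(2,1)] \<delta> by (intro mult_left_mono) auto
    ultimately show ?thesis by (simp add: algebra_simps)
  next
    case False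
    then have "(\<Sum>j<K. indicator (I j) p :: real) = 0" by (intro sum.neutral) auto
    moreover have "p * \<delta> \<le> 1 * \<delta>" using that \<delta> by (intro mult_right_mono) auto
    ultimately show ?thesis by simp
  qed
  have f0_bound: "\<bar>f0 p\<bar> \<le> \<delta>" for p using \<delta> by (simp add: f0_def)
  have SUP0: "\<delta> \<le> (SUP p\<in>{pmin..1}. p * f0 p)"
    using cSUP_upper[of 1 "{pmin..1}" "\<lambda>p. p * f0 p"] bdd_above_revenue(1)[OF pmin(1) f0_bound] pmin
    by (auto simp: f0_def)
  have "\<delta> * ((1 - pmin) / 2) * (\<Sum>i<K. visits f0 (I i) T \<omega>) \<le> run_regret f0 T \<omega>" for \<omega>
  proof -
    have "\<delta> * ((1 - pmin) / 2) * (\<Sum>i<K. visits f0 (I i) T \<omega>)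
        = (\<Sum>t<T. \<delta> * ((1 - pmin) / 2) * (\<Sum>i<K. indicator (I i) (price f0 \<omega> t)))"
      unfolding visits_def by (subst sum.swap) (simp only: sum_distrib_left)
    also have "\<dots> \<le> run_regret f0 T \<omega>"
      unfolding run_regret_def
    proof (rule sum_mono)
      fix t
      show "\<delta> * ((1 - pmin) / 2) * (\<Sum>i<K. indicator (I i) (price f0 \<omega> t))
          \<le> (SUP p\<in>{pmin..1}. p * f0 p) - price f0 \<omega> t * f0 (price f0 \<omega> t)"
        using gap[OF price_range[of f0 \<omega> t]] SUP0 by (simp add: f0_def)
    qed
    finally show ?thesis .
  qed
  then have "(\<integral>\<omega>. \<delta> * ((1 - pmin) / 2) * (\<Sum>i<K. visits f0 (I i) T \<omega>) \<partial>noise T)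
      \<le> (\<integral>\<omega>. run_regret f0 T \<omega> \<partial>noise T)"
    using integrable_visits[OF f0_meas I_meas] integrable_run_regret[OF f0_meas f0_bound]
    by (intro integral_mono) auto
  also have "\<dots> \<le> R" using R by (simp add: f0_def)
  finally have total: "\<delta> * ((1 - pmin) / 2) * (\<Sum>i<K. E0 i) \<le> R"
    using integrable_visits[OF f0_meas I_meas] by (simp add: E0_def)
  define q where "q = R / (\<delta> * ((1 - pmin) / 2) * real K)"
  \<comment> \<open>Averaging: if every \<open>E0 i\<close> exceeded \<open>q\<close>, their sum
    would contradict \<open>total\<close>.\<close>
  obtain i where i: "i < K" "E0 i \<le> q"
  proof (rule ccontr)
    assume "\<not> thesis"
    with that have "\<forall>i<K. q < E0 i" by force
    then have "(\<Sum>i<K. q) < (\<Sum>i<K. E0 i)" using K by (intro sum_strict_mono) auto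
    then have "\<delta> * ((1 - pmin) / 2) * (real K * q) < \<delta> * ((1 - pmin) / 2) * (\<Sum>i<K. E0 i)"
      using \<delta> pmin by (intro mult_strict_left_mono) auto
    also note total
    also have "\<delta> * ((1 - pmin) / 2) * (real K * q) = R"
      using \<delta> pmin K by (simp add: q_def)
    finally show False by simp
  qed
  \<comment> \<open>The height \<open>2 * \<delta> / pmin\<close> brings the revenue at the centre
    to at least \<open>2 * \<delta>\<close> wherever the centre lies, while revenue off the interval
    is at most \<open>\<delta>\<close>. Every period off the interval thus loses at least
    \<open>\<delta>\<close>.\<close>
  define g where "g = (\<lambda>p. \<delta> + 2 * \<delta> / pmin * \<phi> ((p - x i) / h))"
  have g_meas: "g \<in> borel_measurable borel" unfolding g_def by measurable
  have M0: "0 \<le> M" using M[of 0] by simp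
  have g_out: "g p = \<delta>" if "p \<notin> I i" for p
  proof -
    have "1 \<le> \<bar>(p - x i) / h\<bar>" using that h by (simp add: I_def abs_divide)
    then show ?thesis by (simp add: g_def supp)
  qed
  have diff: "\<bar>g p - f0 p\<bar> \<le> 2 * \<delta> / pmin * M * indicator (I i) p" for p
  proof (cases "p \<in> I i")
    case True
    then show ?thesis
      using M[of "(p - x i) / h"] \<delta> pmin by (simp add: g_def f0_def abs_mult divide_right_mono)
  qed (simp add: g_out f0_def)
  have g_bound: "\<bar>g p\<bar> \<le> \<delta> + 2 * \<delta> / pmin * M" for p
  proof -
    have "2 * \<delta> / pmin * M * indicator (I i) p \<le> 2 * \<delta> / pmin * M"
      using \<delta> pmin M0 by (auto simp: indicator_def)
    then show ?thesis using diff[of p] f0_bound[of p] by linarith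
  qed
  note bdd = bdd_above_revenue(1)[OF pmin(1) g_bound]
  have xi: "x i \<in> {pmin..1}"
    using I_left[of "x i" i] i(1) h pmin by (auto simp: I_def x_def)
  have SUP1: "2 * \<delta> \<le> (SUP p\<in>{pmin..1}. p * g p)"
  proof -
    have "2 * \<delta> \<le> pmin * (\<delta> + 2 * \<delta> / pmin)" using \<delta> pmin by (simp add: field_simps)
    also have "\<dots> \<le> x i * (\<delta> + 2 * \<delta> / pmin)" using xi \<delta> pmin by (intro mult_right_mono) auto
    also have "\<dots> = x i * g (x i)" by (simp add: g_def \<phi>0)
    also have "\<dots> \<le> (SUP p\<in>{pmin..1}. p * g p)" using xi bdd by (rule cSUP_upper)
    finally show ?thesis .
  qed
  have "\<delta> * (real T - visits g (I i) T \<omega>) \<le> run_regret g T \<omega>" for \<omega>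
  proof -
    have "\<delta> * (real T - visits g (I i) T \<omega>) = (\<Sum>t<T. \<delta> * (1 - indicator (I i) (price g \<omega> t)))"
      by (simp add: visits_def sum_distrib_left[symmetric] sum_subtractf)
    also have "\<dots> \<le> run_regret g T \<omega>"
      unfolding run_regret_def
    proof (rule sum_mono)
      fix t
      define p where "p = price g \<omega> t"
      have p: "p \<in> {pmin..1}" unfolding p_def by (rule price_range)
      have "\<delta> * (1 - indicator (I i) p) \<le> (SUP p\<in>{pmin..1}. p * g p) - p * g p"
      proof (cases "p \<in> I i")
        case True
        then show ?thesis using cSUP_upper[OF p bdd] by simp
      next
        case False
        have "p * \<delta> \<le> 1 * \<delta>" using p \<delta> by (intro mult_right_mono) auto
        then show ?thesis using False SUP1 by (simp add: g_out)
      qed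
      then show "\<delta> * (1 - indicator (I i) (price g \<omega> t))
          \<le> (SUP p\<in>{pmin..1}. p * g p) - price g \<omega> t * g (price g \<omega> t)"
        unfolding p_def .
    qed
    finally show ?thesis .
  qed
  then have "(\<integral>\<omega>. \<delta> * (real T - visits g (I i) T \<omega>) \<partial>noise T) \<le> (\<integral>\<omega>. run_regret g T \<omega> \<partial>noise T)"
    using integrable_visits[OF g_meas I_meas] integrable_run_regret[OF g_meas g_bound]
    by (intro integral_mono) auto
  also have "(\<integral>\<omega>. \<delta> * (real T - visits g (I i) T \<omega>) \<partial>noise T)
      = \<delta> * (real T - (\<integral>\<omega>. visits g (I i) T \<omega> \<partial>noise T))"
    using integrable_visits[OF g_meas I_meas] by (simp add: noise.prob_space)
  finally have reg: "\<delta> * (real T - (\<integral>\<omega>. visits g (I i) T \<omega> \<partial>noise T)) \<le> (\<integral>\<omega>. run_regret g T \<omega> \<partial>noise T)" .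
  have "(\<integral>\<omega>. visits g (I i) T \<omega> \<partial>noise T) \<le> E0 i * (2 + real T * (2 * \<delta> / pmin * M / \<sigma>)\<^sup>2)"
    unfolding E0_def
    by (rule expected_visits_change[OF f0_meas g_meas I_meas diff]) (use \<delta> pmin M0 T in auto)
  also have "\<dots> \<le> q * (2 + real T * (2 * \<delta> / pmin * M / \<sigma>)\<^sup>2)"
    using i by (intro mult_right_mono) auto
  also have "\<dots> \<le> real T / 2" unfolding q_def by (rule small)
  finally have "\<delta> * (real T / 2) \<le> \<delta> * (real T - (\<integral>\<omega>. visits g (I i) T \<omega> \<partial>noise T))"
    using \<delta> by (intro mult_left_mono) auto
  with reg have "\<delta> * real T / 2 \<le> (\<integral>\<omega>. run_regret g T \<omega> \<partial>noise T)" by simp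
  then show ?thesis unfolding g_def by blast
qed

end

section \<open>Transfer to \<open>regret\<close> and its supremum over a class\<close>

lemma admissible_pricingI:
  assumes "admissible pmin \<pi>" "0 < pmin" "pmin < 1" "0 < \<sigma>"
  shows "admissible_pricing (\<pi> T) \<sigma> pmin"
  using assms unfolding admissible_def by unfold_locales auto

lemma regret_eq:
  assumes "admissible_pricing (\<pi> T) \<sigma> pmin"
  shows "regret pmin \<sigma> \<pi> f T = (\<integral>\<omega>. admissible_pricing.run_regret (\<pi> T) \<sigma> pmin f T \<omega> \<partial>noise T)"
proof -
  interpret admissible_pricing "\<pi> T" \<sigma> pmin by fact
  show ?thesis unfolding regret_def run_regret_def
    by (intro Bochner_Integration.integral_cong refl sum.cong) (simp add: fst_hist_nth)
qed

text \<open>Lets the supremum over the class dominate the regret on the particular bump that is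
  found.\<close>

lemma bdd_above_regret:
  assumes "admissible_pricing (\<pi> T) \<sigma> pmin"
  shows "bdd_above ((\<lambda>f. regret pmin \<sigma> \<pi> f T) ` Hclass pmin \<beta> L)"
proof (rule bdd_aboveI2)
  interpret admissible_pricing "\<pi> T" \<sigma> pmin by fact
  fix f assume f: "f \<in> Hclass pmin \<beta> L"
  have L: "0 \<le> L" using Hclass_bounded[OF f, of 1] pmin by simp
  have "(\<integral>\<omega>. run_regret f T \<omega> \<partial>noise T) \<le> 2 * L * real T"
  \<comment> \<open>The class constrains \<open>f\<close> only on the price interval, so Borel
    measurability of \<open>f\<close> is not at hand. A non-integrable function has integral 0 by
    convention, and \<open>0 \<le> L\<close> settles that case.\<close>
  proof (cases "integrable (noise T) (run_regret f T)")
    case True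
    have "run_regret f T \<omega> \<le> 2 * L * real T" for \<omega>
      by (rule abs_le_D1[OF run_regret_le]) (rule Hclass_bounded[OF f])
    then show ?thesis by (intro noise.integral_le_const[OF True]) simp
  qed (use L in \<open>simp add: not_integrable_integral_eq\<close>)
  then show "regret pmin \<sigma> \<pi> f T \<le> 2 * L * real T"
    unfolding regret_eq[of \<pi>, OF assms] .
qed

section \<open>Choice of the rates\<close>

text \<open>\<open>\<gamma>\<close> is the decay exponent of the bump height, and
  \<open>1 - \<gamma>\<close> is the claimed rate. The last two inequalities make the powers of
  \<open>T\<close> in the visit bound negative.\<close>

lemma rate_exponents:
  fixes \<alpha> \<beta> \<gamma> :: real
  assumes "0 < \<beta>" "\<beta> < \<alpha>"
    and \<gamma>: "\<gamma> = 1 - ((\<beta> + 1) / (2 * \<beta> + 1) + \<beta> * (\<alpha> - \<beta>) / (2 * (2 * \<beta> + 1)^2 * (2 * \<alpha> + 1)))"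
  shows "0 < \<gamma>" "2 * \<gamma> < 1" "(\<alpha> + 1) / (2 * \<alpha> + 1) < \<gamma> / \<beta> + \<gamma>"
proof -
  define a where "a = 2 * \<alpha> + 1"
  define b where "b = 2 * \<beta> + 1"
  \<comment> \<open>The optimal rates for \<open>\<alpha>\<close> and \<open>\<beta>\<close> enter
    through \<open>(\<beta> + 1) / b - (\<alpha> + 1) / a = 2 * z\<close>. Since
    \<open>\<gamma> = \<beta> / b * (1 - z)\<close>, the sum
    \<open>\<gamma> / \<beta> + \<gamma>\<close> falls short of \<open>(\<beta> + 1) / b\<close> by
    less than \<open>z\<close>, so a margin above \<open>z\<close> remains.\<close>
  define z where "z = (\<alpha> - \<beta>) / (2 * b * a)"
  have ab: "a > 0" "b > 0" using assms by (auto simp: a_def b_def)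
  have z: "0 < z" using assms ab by (simp add: z_def)
  have "\<alpha> - \<beta> < 2 * b * a"
  proof -
    have "1 * a < 2 * b * a" using assms ab by (intro mult_strict_right_mono) (auto simp: b_def)
    moreover have "\<alpha> - \<beta> < a" using assms by (simp add: a_def)
    ultimately show ?thesis by linarith
  qed
  then have z1: "z < 1" using ab by (simp add: z_def)
  have \<gamma>': "\<gamma> = \<beta> / b * (1 - z)"
  proof -
    have "1 - (\<beta> + 1) / b = \<beta> / b" using ab by (simp add: field_simps b_def)
    moreover have "\<beta> * (\<alpha> - \<beta>) / (2 * b\<^sup>2 * a) = \<beta> / b * z"
      using ab by (simp add: z_def power2_eq_square)
    ultimately show ?thesis unfolding \<gamma> a_def[symmetric] b_def[symmetric]
      by (simp add: right_diff_distrib)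
  qed
  show "0 < \<gamma>" unfolding \<gamma>' using assms ab z1 by simp
  have "\<gamma> < \<beta> / b * 1"
    unfolding \<gamma>' using assms ab z by (intro mult_strict_left_mono) auto
  also have "\<dots> < 1 / 2" using ab by (simp add: field_simps b_def)
  finally show "2 * \<gamma> < 1" by simp
  have sum: "\<gamma> / \<beta> + \<gamma> = (\<beta> + 1) / b - (\<beta> + 1) / b * z"
    using assms(1) ab by (simp add: \<gamma>' field_simps)
  have "(\<beta> + 1) / b * z < 1 * z"
    using assms(1) ab z by (intro mult_strict_right_mono) (auto simp: b_def)
  moreover have "(\<beta> + 1) / b - (\<alpha> + 1) / a = 2 * z"
  proof -
    have "(\<beta> + 1) / b - (\<alpha> + 1) / a = ((\<beta> + 1) * a - (\<alpha> + 1) * b) / (b * a)"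
      using ab by (simp add: diff_frac_eq)
    also have "(\<beta> + 1) * a - (\<alpha> + 1) * b = \<alpha> - \<beta>" by (simp add: a_def b_def algebra_simps)
    also have "(\<alpha> - \<beta>) / (b * a) = 2 * z" using ab by (simp add: z_def field_simps)
    finally show ?thesis .
  qed
  ultimately show "(\<alpha> + 1) / (2 * \<alpha> + 1) < \<gamma> / \<beta> + \<gamma>"
    unfolding sum a_def[symmetric] using z by linarith
qed

text \<open>A strictly negative power of \<open>T\<close> absorbs the constants and logarithms of
  the regret hypothesis.\<close>

lemma powr_mult_ln_power_tendsto_0:
  fixes D s :: real
  assumes "s < 0"
  shows "((\<lambda>T. D * real T powr s * ln (real T) ^ k) \<longlongrightarrow> 0) sequentially"
  using assms by real_asymp

theorem theorem1:
  fixes pmin \<alpha> \<beta> L\<alpha> L\<beta> \<sigma> :: real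
  assumes "0 < pmin" "pmin < 1" "0 < \<beta>" "\<beta> < \<alpha>" "0 < L\<alpha>" "0 < L\<beta>" "0 < \<sigma>"
  shows "\<exists>C>0. \<forall>\<pi>. admissible pmin \<pi> \<and>
      (\<exists>c (k::nat) T0. \<forall>T\<ge>T0. \<forall>f\<in>Hclass pmin \<alpha> L\<alpha>.
          regret pmin \<sigma> \<pi> f T \<le> c * real T powr ((\<alpha> + 1) / (2 * \<alpha> + 1)) * ln (real T) ^ k)
      \<longrightarrow> (\<exists>T0. \<forall>T\<ge>T0.
          (SUP f\<in>Hclass pmin \<beta> L\<beta>. regret pmin \<sigma> \<pi> f T)
            \<ge> C * real T powr ((\<beta> + 1) / (2 * \<beta> + 1)
                 + \<beta> * (\<alpha> - \<beta>) / (2 * (2 * \<beta> + 1)^2 * (2 * \<alpha> + 1))))"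
proof -
  note pmin = assms(1,2) and \<beta> = assms(3)
  define \<rho> where "\<rho> = (\<alpha> + 1) / (2 * \<alpha> + 1)"
  define e where "e = (\<beta> + 1) / (2 * \<beta> + 1) + \<beta> * (\<alpha> - \<beta>) / (2 * (2 * \<beta> + 1)^2 * (2 * \<alpha> + 1))"
  define \<gamma> where "\<gamma> = 1 - e"
  have \<gamma>: "0 < \<gamma>" "2 * \<gamma> < 1" "\<rho> < \<gamma> / \<beta> + \<gamma>"
    using rate_exponents[OF assms(3,4), of \<gamma>] unfolding \<gamma>_def e_def \<rho>_def by auto
  obtain \<phi> :: "nat \<Rightarrow> real \<Rightarrow> real" and M where M: "M > 0" and \<phi>0: "\<phi> 0 0 = 1"
    and supp: "\<And>x. 1 \<le> \<bar>x\<bar> \<Longrightarrow> \<phi> 0 x = 0"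
    and deriv: "\<And>k x. k \<le> wdeg \<beta> \<Longrightarrow> (\<phi> k has_real_derivative \<phi> (Suc k) x) (at x)"
    and bound: "\<And>k x. k \<le> Suc (wdeg \<beta>) \<Longrightarrow> \<bar>\<phi> k x\<bar> \<le> M"
    using smooth_bump_exists[of "wdeg \<beta>"] by metis
  have \<phi>_meas: "\<phi> 0 \<in> borel_measurable borel"
    by (intro borel_measurable_continuous_onI DERIV_continuous_on[where D = "\<phi> 1"]) (use deriv[of 0] in simp)
  \<comment> \<open>With \<open>h powr \<beta> = c1 * \<delta>\<close>, this value gives equality in
    the height condition of \<open>scaled_bump_in_Hclass\<close> for
    \<open>B = 2 * \<delta> / pmin\<close>. The bump is as narrow as that condition permits.\<close>
  define c1 where "c1 = 8 * M / (pmin * L\<beta>)"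
  have c1: "c1 > 0" using M pmin assms by (simp add: c1_def)
  \<comment> \<open>\<open>A * \<delta> T\<close> bounds the size of the bump in units of the noise
    level.\<close>
  define A where "A = 2 * M / (pmin * \<sigma>)"
  define \<delta> where "\<delta> T = real T powr (-\<gamma>)" for T
  define h where "h T = (c1 * \<delta> T) powr (1 / \<beta>)" for T
  show ?thesis
  \<comment> \<open>The constant is the same for all parameters: in expectation at least half of the
    periods lose \<open>\<delta> T\<close>, and \<open>\<delta> T * real T\<close> equals
    \<open>real T powr e\<close>.\<close>
  proof (intro exI[of _ "1/2"] conjI allI impI)
    fix \<pi>
    assume "admissible pmin \<pi> \<and> (\<exists>c (k::nat) T0. \<forall>T\<ge>T0. \<forall>f\<in>Hclass pmin \<alpha> L\<alpha>.
          regret pmin \<sigma> \<pi> f T \<le> c * real T powr ((\<alpha> + 1) / (2 * \<alpha> + 1)) * ln (real T) ^ k)"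
    then obtain c k T0 where adm: "admissible pmin \<pi>"
      and upper: "\<And>T f. T \<ge> T0 \<Longrightarrow> f \<in> Hclass pmin \<alpha> L\<alpha> \<Longrightarrow>
         regret pmin \<sigma> \<pi> f T \<le> c * real T powr \<rho> * ln (real T) ^ k"
      unfolding \<rho>_def by blast
    \<comment> \<open>Constants of the visit bound: 16 is the 2 from the loss on the left half times
      the 8 from the lower bound on \<open>K\<close>.\<close>
    define D where "D = \<bar>c\<bar> * 16 * c1 powr (1 / \<beta>) / (1 - pmin)\<^sup>2"
    \<comment> \<open>By \<open>\<rho> < \<gamma> / \<beta> + \<gamma>\<close>, the first exponent
      lies below \<open>2 * \<gamma> - 1\<close>, which is negative.\<close>
    have s1: "\<rho> - \<gamma> / \<beta> + \<gamma> - 1 < 0" and s2: "\<rho> - \<gamma> / \<beta> - \<gamma> < 0" using \<gamma> by auto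
    have \<delta>_lim: "\<delta> \<longlonglongrightarrow> 0"
      unfolding \<delta>_def using \<gamma>(1) by real_asymp
    have h_lim: "h \<longlonglongrightarrow> 0"
    proof -
      have "(\<lambda>T. (c1 * \<delta> T) powr (1 / \<beta>)) \<longlonglongrightarrow> (c1 * 0) powr (1 / \<beta>)"
        using \<beta> c1 by (intro tendsto_powr2 tendsto_intros \<delta>_lim)
          (auto simp: \<delta>_def intro!: always_eventually)
      then show ?thesis unfolding h_def by simp
    qed
    have "\<forall>\<^sub>F T in sequentially. T \<ge> max 1 T0 \<and> \<delta> T < min L\<alpha> (L\<beta> / 2) \<and> h T < (1 - pmin) / 4
        \<and> D * real T powr (\<rho> - \<gamma> / \<beta> + \<gamma> - 1) * ln (real T) ^ k < 1 / 8
        \<and> (D * A\<^sup>2) * real T powr (\<rho> - \<gamma> / \<beta> - \<gamma>) * ln (real T) ^ k < 1 / 4"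
      by (intro eventually_conj eventually_ge_at_top order_tendstoD(2)[OF \<delta>_lim]
          order_tendstoD(2)[OF h_lim] order_tendstoD(2)[OF powr_mult_ln_power_tendsto_0[OF s1]]
          order_tendstoD(2)[OF powr_mult_ln_power_tendsto_0[OF s2]]) (use assms in auto)
    then obtain T1 where T1: "\<And>T. T \<ge> T1 \<Longrightarrow> T \<ge> max 1 T0 \<and> \<delta> T < min L\<alpha> (L\<beta> / 2) \<and> h T < (1 - pmin) / 4
        \<and> D * real T powr (\<rho> - \<gamma> / \<beta> + \<gamma> - 1) * ln (real T) ^ k < 1 / 8
        \<and> (D * A\<^sup>2) * real T powr (\<rho> - \<gamma> / \<beta> - \<gamma>) * ln (real T) ^ k < 1 / 4"
      unfolding eventually_sequentially by blast
    have "1 / 2 * real T powr e \<le> (SUP f\<in>Hclass pmin \<beta> L\<beta>. regret pmin \<sigma> \<pi> f T)" if "T \<ge> T1" for T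
    proof -
      have T: "T \<ge> T0" "0 < real T" and \<delta>_small: "\<delta> T \<le> L\<alpha>" "\<delta> T \<le> L\<beta> / 2" and h_small: "h T < (1 - pmin) / 4"
        and Q1: "D * real T powr (\<rho> - \<gamma> / \<beta> + \<gamma> - 1) * ln (real T) ^ k < 1 / 8"
        and Q2: "(D * A\<^sup>2) * real T powr (\<rho> - \<gamma> / \<beta> - \<gamma>) * ln (real T) ^ k < 1 / 4"
        using T1[OF that] by auto
      have ln: "0 \<le> ln (real T)" using T1[OF that] by auto
      have \<delta>: "0 < \<delta> T" using T by (simp add: \<delta>_def)
      have h: "0 < h T" using c1 \<delta> by (simp add: h_def)
      interpret admissible_pricing "\<pi> T" \<sigma> pmin
        by (rule admissible_pricingI) fact+
      \<comment> \<open>The number of intervals of length \<open>2 * h T\<close> that fit into the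
        left half, of length \<open>(1 - pmin) / 2\<close>. As \<open>1 \<le> y\<close>, rounding
        down loses at most a factor 2.\<close>
      define y where "y = (1 - pmin) / (4 * h T)"
      define K where "K = nat \<lfloor>y\<rfloor>"
      have y: "1 \<le> y" using h h_small by (simp add: y_def field_simps)
      then have K_floor: "real K = of_int \<lfloor>y\<rfloor>"
        unfolding K_def by (intro of_nat_nat) simp
      have K_le: "real K \<le> (1 - pmin) / (4 * h T)"
        unfolding K_floor y_def[symmetric] by (rule of_int_floor_le)
      have K1: "1 \<le> real K" unfolding K_floor using y by simp
      have "y / 2 \<le> real K" using K1 unfolding K_floor by linarith
      then have K_ge: "(1 - pmin) / (8 * h T) \<le> real K" by (simp add: y_def)
      \<comment> \<open>The sign of \<open>c\<close> is not fixed; the absolute value makes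
        \<open>R\<close> nonnegative, so that the lower bound on \<open>K\<close> can be inserted in
        the denominator.\<close>
      define R where "R = \<bar>c\<bar> * real T powr \<rho> * ln (real T) ^ k"
      have R0: "0 \<le> R" using ln by (simp add: R_def)
      have "regret pmin \<sigma> \<pi> (\<lambda>_. \<delta> T) T \<le> c * real T powr \<rho> * ln (real T) ^ k"
        using assms \<delta> \<delta>_small T by (intro upper const_in_Hclass) auto
      also have "\<dots> \<le> R" unfolding R_def using ln by (intro mult_right_mono) auto
      finally have R: "(\<integral>\<omega>. run_regret (\<lambda>_. \<delta> T) T \<omega> \<partial>noise T) \<le> R"
        by (simp add: regret_eq[of \<pi>, OF admissible_pricing_axioms])
      have fit: "pmin + 2 * h T * real K \<le> (1 + pmin) / 2"
        using K_le h by (simp add: field_simps)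
      \<comment> \<open>Closed form of the bound on expected visits to the chosen interval, using
        that \<open>h T / \<delta> T\<close> has order
        \<open>T powr (\<gamma> - \<gamma> / \<beta>)\<close>.\<close>
      define Q where "Q = D * real T powr (\<rho> - \<gamma> / \<beta> + \<gamma>) * ln (real T) ^ k"
      have "R / (\<delta> T * ((1 - pmin) / 2) * real K) \<le> R / (\<delta> T * ((1 - pmin) / 2) * ((1 - pmin) / (8 * h T)))"
        using R0 \<delta> pmin K_ge K1 h by (intro divide_left_mono mult_left_mono mult_pos_pos) auto
      also have "\<dots> = R * 16 * (h T / \<delta> T) / (1 - pmin)\<^sup>2"
        by (simp add: power2_eq_square mult.assoc)
      also have "h T / \<delta> T = c1 powr (1 / \<beta>) * real T powr (\<gamma> - \<gamma> / \<beta>)"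
      proof -
        have "h T / \<delta> T = c1 powr (1 / \<beta>) * (real T powr (- (\<gamma> / \<beta>)) / real T powr (- \<gamma>))"
          using T c1 by (simp add: h_def \<delta>_def powr_mult powr_powr)
        then show ?thesis by (simp flip: powr_diff)
      qed
      also have "R * 16 * (c1 powr (1 / \<beta>) * real T powr (\<gamma> - \<gamma> / \<beta>)) / (1 - pmin)\<^sup>2
          = D * (real T powr \<rho> * real T powr (\<gamma> - \<gamma> / \<beta>)) * ln (real T) ^ k"
        by (simp add: R_def D_def)
      also have "\<dots> = Q" unfolding Q_def by (simp add: algebra_simps flip: powr_add)
      finally have q: "R / (\<delta> T * ((1 - pmin) / 2) * real K) \<le> Q" .
      have Q_T: "Q = D * real T powr (\<rho> - \<gamma> / \<beta> + \<gamma> - 1) * ln (real T) ^ k * real T"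
        using T by (simp add: Q_def powr_diff)
      \<comment> \<open>The budget \<open>real T / 2\<close> is split evenly: \<open>2 * Q\<close>
        takes one quarter of \<open>T\<close> by \<open>Q1\<close>, and the information term takes
        the other by \<open>Q2\<close>.\<close>
      have Q_le: "2 * Q \<le> real T / 4"
        using mult_strict_right_mono[OF Q1 T(2)] unfolding Q_T by simp
      have "Q * A\<^sup>2 * (\<delta> T)\<^sup>2 = (D * A\<^sup>2) * (real T powr (\<rho> - \<gamma> / \<beta> + \<gamma>) * (\<delta> T)\<^sup>2) * ln (real T) ^ k"
        by (simp add: Q_def)
      also have "real T powr (\<rho> - \<gamma> / \<beta> + \<gamma>) * (\<delta> T)\<^sup>2 = real T powr (\<rho> - \<gamma> / \<beta> - \<gamma>)"
        by (simp add: \<delta>_def power2_eq_square flip: powr_add)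
      finally have "Q * A\<^sup>2 * (\<delta> T)\<^sup>2 \<le> 1 / 4" using Q2 by linarith
      then have "real T * (Q * A\<^sup>2 * (\<delta> T)\<^sup>2) \<le> real T * (1 / 4)"
        using T by (intro mult_left_mono) auto
      with Q_le have Q_small: "Q * (2 + real T * (A * \<delta> T)\<^sup>2) \<le> real T / 2"
        by (simp add: algebra_simps power_mult_distrib)
      have A_eq: "2 * \<delta> T / pmin * M / \<sigma> = A * \<delta> T" by (simp add: A_def)
      have small: "R / (\<delta> T * ((1 - pmin) / 2) * real K) * (2 + real T * (2 * \<delta> T / pmin * M / \<sigma>)\<^sup>2) \<le> real T / 2"
        unfolding A_eq by (rule order_trans[OF mult_right_mono[OF q] Q_small]) simp
      obtain x0 where x0: "\<delta> T * real T / 2 \<le>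
          (\<integral>\<omega>. run_regret (\<lambda>p. \<delta> T + 2 * \<delta> T / pmin * \<phi> 0 ((p - x0) / h T)) T \<omega> \<partial>noise T)"
        using needle_lower_bound[OF \<phi>_meas \<phi>0 supp bound[of 0] \<delta> h _ _ fit R small] K1 T by auto
      have h\<beta>: "h T powr \<beta> = c1 * \<delta> T"
        using \<beta> c1 \<delta> by (simp add: h_def powr_powr)
      have "4 * M * (2 * \<delta> T / pmin) \<le> L\<beta> * h T powr \<beta>"
        unfolding h\<beta> c1_def using pmin assms by (simp add: field_simps)
      then have mem: "(\<lambda>p. \<delta> T + 2 * \<delta> T / pmin * \<phi> 0 ((p - x0) / h T)) \<in> Hclass pmin \<beta> L\<beta>"
        using \<beta> h h_small M deriv bound \<delta> \<delta>_small pmin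
        by (intro scaled_bump_in_Hclass[where M = M and \<phi> = \<phi>]) auto
      have "1 / 2 * real T powr e = \<delta> T * real T / 2"
        using T by (simp add: \<delta>_def \<gamma>_def powr_diff)
      also have "\<dots> \<le> regret pmin \<sigma> \<pi> (\<lambda>p. \<delta> T + 2 * \<delta> T / pmin * \<phi> 0 ((p - x0) / h T)) T"
        using x0 by (simp add: regret_eq[of \<pi>, OF admissible_pricing_axioms])
      also have "\<dots> \<le> (SUP f\<in>Hclass pmin \<beta> L\<beta>. regret pmin \<sigma> \<pi> f T)"
        using mem bdd_above_regret[of \<pi>, OF admissible_pricing_axioms] by (rule cSUP_upper)
      finally show ?thesis .
    qed
    then show "\<exists>T0. \<forall>T\<ge>T0. (SUP f\<in>Hclass pmin \<beta> L\<beta>. regret pmin \<sigma> \<pi> f T)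
            \<ge> 1 / 2 * real T powr ((\<beta> + 1) / (2 * \<beta> + 1)
                 + \<beta> * (\<alpha> - \<beta>) / (2 * (2 * \<beta> + 1)^2 * (2 * \<alpha> + 1)))"
      unfolding e_def by blast
  qed simp
qed

end
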